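(* Let $\mathcal{Q}_0,\mathcal{Q}_1:\mathrm{L}(\mathcal{X})\to\mathrm{L}(\mathcal{Y})$ be admissible quantum channels, let $\Xi:\mathrm{L}(\mathcal{X}_0\otimes\mathcal{X}_1)\to\mathrm{L}(\mathcal{Z}\otimes\mathcal{Q})$ be the super-operator constructed from them as described in the context, let $N=\dim(\mathcal{X}_0\otimes\mathcal{X}_1)\ge 2$, and let $\delta>0$. Put $\varepsilon=\delta/4$ and $T=\left\lceil \frac{16\ln N}{\delta^2}\right\rceil$. Run the following iteration (in exact arithmetic): set $W^{(1)}=\mathbb{1}_{\mathcal{X}_0\otimes\mathcal{X}_1}$, and for $t=1,\dots,T$ let $$\rho^{(t)}=W^{(t)}/\operatorname{Tr}W^{(t)},$$ let $\Pi^{(t)}$ be the projection onto the positive eigenspaces of $\Xi(\rho^{(t)})$ (the span of eigenvectors with positive eigenvalue), and let $$M^{(t)}=\tfrac12\bigl(\Xi^*(\Pi^{(t)})+\mathbb{1}_{\mathcal{X}_0\otimes\mathcal{X}_1}\bigr),\qquad W^{(t+1)}=\exp\Bigl(-\varepsilon\sum_{\tau=1}^{t}M^{(\tau)}\Bigr).$$ Then the returned value $$\lambda=\frac1T\sum_{t=1}^{T}\langle\Pi^{(t)},\Xi(\rho^{(t)})\rangle$$ satisfies $$|\lambda-\check{\lambda}(\Xi)|\le\delta .$$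
   Context: For finite-dimensional complex Euclidean spaces, $\mathrm{L}(\mathcal{X})$ denotes linear operators on $\mathcal{X}$, $\mathrm{D}(\mathcal{X})$ density operators, $\langle A,B\rangle=\operatorname{Tr}(A^*B)$, and $\le$ is the positive semidefinite order on Hermitian operators. An admissible channel is a completely positive trace-preserving linear map. The adjoint $\Xi^*$ is defined by $\langle B,\Xi(A)\rangle=\langle\Xi^*(B),A\rangle$ for all $A,B$. Construction of $\Xi$: write $\mathcal{Q}_i(X)=\operatorname{Tr}_{\mathcal{Z}}(A_iXA_i^* )$, $i=0,1$, with linear isometries $A_0,A_1\in\mathrm{L}(\mathcal{X},\mathcal{Y}\otimes\mathcal{Z})$ (Stinespring representations with a common auxiliary space $\mathcal{Z}$). Let $\mathcal{Q}=\mathbb{C}^2$ with standard basis $e_0,e_1$, and define $C_0,C_1\in\mathrm{L}(\mathcal{X},\mathcal{Y}\otimes\mathcal{Z}\otimes\mathcal{Q})$ by $$C_0x=\tfrac1{\sqrt2}(A_0x\otimes e_0+A_1x\otimes e_1),\qquad C_1x=\tfrac1{\sqrt2}(A_0x\otimes e_0-A_1x\otimes e_1).$$ Set $\Phi_A(X)=\operatorname{Tr}_{\mathcal{Y}}(C_0XC_0^* )$ and $\Phi_B(X)=\operatorname{Tr}_{\mathcal{Y}}(C_1XC_1^* )$, maps $\mathrm{L}(\mathcal{X})\to\mathrm{L}(\mathcal{Z}\otimes\mathcal{Q})$. With $\mathcal{X}_0,\mathcal{X}_1$ isomorphic copies of $\mathcal{X}$, set for $X\in\mathrm{L}(\mathcal{X}_0\otimes\mathcal{X}_1)$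 $$\widetilde{\Phi_A}(X)=\Phi_A(\operatorname{Tr}_{\mathcal{X}_1}X),\quad \widetilde{\Phi_B}(X)=\Phi_B(\operatorname{Tr}_{\mathcal{X}_0}X),\quad \Xi=\widetilde{\Phi_A}-\widetilde{\Phi_B}.$$ The equilibrium value of $\Xi$ is $$\check{\lambda}(\Xi)=\min_{\rho\in\mathrm{D}(\mathcal{X}_0\otimes\mathcal{X}_1)}\max_{\Pi\in\Gamma}\langle\Pi,\Xi(\rho)\rangle=\max_{\Pi\in\Gamma}\min_{\rho\in\mathrm{D}(\mathcal{X}_0\otimes\mathcal{X}_1)}\langle\Pi,\Xi(\rho)\rangle,\qquad\Gamma=\{\Pi:0\le\Pi\le\mathbb{1}_{\mathcal{Z}\otimes\mathcal{Q}}\}.$$ *)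

theory Defs
  imports "HOL-Analysis.Analysis"
begin

(* An operator from C^'n to C^'m is a matrix complex^'n^'m (rows indexed by 'm).
   The tensor product of spaces with bases 'a, 'b has basis 'a \<times> 'b; products of
   three spaces are bracketed to the right: Y \<otimes> (Z \<otimes> Q) has basis 'y \<times> 'z \<times> 2. *)

definition cdot :: "complex^'n \<Rightarrow> complex^'n \<Rightarrow> complex" where
  "cdot u v = (\<Sum>i\<in>UNIV. cnj (u $ i) * v $ i)"

definition hadj :: "complex^'n^'m \<Rightarrow> complex^'m^'n" where
  "hadj A = (\<chi> i j. cnj (A $ j $ i))"

(* The library has no complex scalar multiplication on complex^'n^'m:
   there *s takes a row vector as the scalar and acts componentwise. *)
definition cscale :: "complex \<Rightarrow> complex^'n^'m \<Rightarrow> complex^'n^'m" where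
  "cscale c A = (\<chi> i j. c * A $ i $ j)"

definition hs_inner :: "complex^'n^'n \<Rightarrow> complex^'n^'n \<Rightarrow> complex" where
  "hs_inner A B = trace (hadj A ** B)"

definition psd :: "complex^'n^'n \<Rightarrow> bool" where
  "psd A \<longleftrightarrow> hadj A = A \<and> (\<forall>v. 0 \<le> Re (cdot v (A *v v)))"

definition loewner_le :: "complex^'n^'n \<Rightarrow> complex^'n^'n \<Rightarrow> bool" where
  "loewner_le A B \<longleftrightarrow> psd (B - A)"

definition density_ops :: "(complex^'n^'n) set" where
  "density_ops = {\<rho>. psd \<rho> \<and> trace \<rho> = 1}"

definition measurement_ops :: "(complex^'n^'n) set" where
  "measurement_ops = {P. loewner_le 0 P \<and> loewner_le P (mat 1)}"

definition isometry :: "complex^'n^'m \<Rightarrow> bool" where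
  "isometry A \<longleftrightarrow> hadj A ** A = mat 1"

definition ptrace_fst :: "complex^('a::finite \<times> 'b::finite)^('a \<times> 'b) \<Rightarrow> complex^'b^'b" where
  "ptrace_fst M = (\<chi> i j. \<Sum>k\<in>UNIV. M $ (k, i) $ (k, j))"

definition ptrace_snd :: "complex^('a::finite \<times> 'b::finite)^('a \<times> 'b) \<Rightarrow> complex^'a^'a" where
  "ptrace_snd M = (\<chi> i j. \<Sum>k\<in>UNIV. M $ (i, k) $ (j, k))"


definition superop_linear :: "(complex^'n^'n \<Rightarrow> complex^'m^'m) \<Rightarrow> bool" where
  "superop_linear \<Phi> \<longleftrightarrow>
     (\<forall>A B. \<Phi> (A + B) = \<Phi> A + \<Phi> B) \<and> (\<forall>c A. \<Phi> (cscale c A) = cscale c (\<Phi> A))"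

(* An operator on C^n \<otimes> X is an n \<times> n array B of operators on X (B i j, i, j < n), and a
   vector of C^n \<otimes> X an n-tuple v of vectors of X. In this form id \<otimes> \<Phi> acts blockwise. *)
definition block_psd :: "nat \<Rightarrow> (nat \<Rightarrow> nat \<Rightarrow> complex^'n^'n) \<Rightarrow> bool" where
  "block_psd n B \<longleftrightarrow>
     (\<forall>i<n. \<forall>j<n. hadj (B i j) = B j i) \<and>
     (\<forall>v :: nat \<Rightarrow> complex^'n. 0 \<le> Re (\<Sum>i<n. \<Sum>j<n. cdot (v i) (B i j *v v j)))"

definition completely_positive :: "(complex^'n^'n \<Rightarrow> complex^'m^'m) \<Rightarrow> bool" where
  "completely_positive \<Phi> \<longleftrightarrow> (\<forall>n B. block_psd n B \<longrightarrow> block_psd n (\<lambda>i j. \<Phi> (B i j)))"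

definition trace_preserving :: "(complex^'n^'n \<Rightarrow> complex^'m^'m) \<Rightarrow> bool" where
  "trace_preserving \<Phi> \<longleftrightarrow> (\<forall>A. trace (\<Phi> A) = trace A)"

definition admissible_channel :: "(complex^'n^'n \<Rightarrow> complex^'m^'m) \<Rightarrow> bool" where
  "admissible_channel \<Phi> \<longleftrightarrow>
     superop_linear \<Phi> \<and> completely_positive \<Phi> \<and> trace_preserving \<Phi>"

(* Unique existence holds for every linear \<Phi>. *)
definition superop_adjoint ::
    "(complex^'n^'n \<Rightarrow> complex^'m^'m) \<Rightarrow> complex^'m^'m \<Rightarrow> complex^'n^'n" where
  "superop_adjoint \<Phi> = (THE \<Psi>. \<forall>A B. hs_inner B (\<Phi> A) = hs_inner (\<Psi> B) A)"


(* x \<mapsto> A x \<otimes> e *)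
definition tensor_ket ::
    "complex^'x^('y::finite \<times> 'z::finite) \<Rightarrow> complex^'q \<Rightarrow> complex^'x^('y \<times> 'z \<times> 'q)" where
  "tensor_ket A e = (\<chi> p x. case p of (y, z, q) \<Rightarrow> A $ (y, z) $ x * e $ q)"

(* The index type 2 has the elements 0 and 1, so axis 0 1 and axis 1 1 are e_0 and e_1. *)
definition C0 ::
    "complex^'x^('y::finite \<times> 'z::finite) \<Rightarrow> complex^'x^('y \<times> 'z) \<Rightarrow> complex^'x^('y \<times> 'z \<times> 2)" where
  "C0 A0 A1 = (1 / sqrt 2) *\<^sub>R (tensor_ket A0 (axis 0 1) + tensor_ket A1 (axis 1 1))"

definition C1 ::
    "complex^'x^('y::finite \<times> 'z::finite) \<Rightarrow> complex^'x^('y \<times> 'z) \<Rightarrow> complex^'x^('y \<times> 'z \<times> 2)" where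
  "C1 A0 A1 = (1 / sqrt 2) *\<^sub>R (tensor_ket A0 (axis 0 1) - tensor_ket A1 (axis 1 1))"

definition Phi_A ::
    "complex^'x^('y::finite \<times> 'z::finite) \<Rightarrow> complex^'x^('y \<times> 'z) \<Rightarrow>
     complex^'x^'x \<Rightarrow> complex^('z \<times> 2)^('z \<times> 2)" where
  "Phi_A A0 A1 X = ptrace_fst (C0 A0 A1 ** X ** hadj (C0 A0 A1))"

definition Phi_B ::
    "complex^'x^('y::finite \<times> 'z::finite) \<Rightarrow> complex^'x^('y \<times> 'z) \<Rightarrow>
     complex^'x^'x \<Rightarrow> complex^('z \<times> 2)^('z \<times> 2)" where
  "Phi_B A0 A1 X = ptrace_fst (C1 A0 A1 ** X ** hadj (C1 A0 A1))"

definition Xi ::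
    "complex^'x^('y::finite \<times> 'z::finite) \<Rightarrow> complex^'x^('y \<times> 'z) \<Rightarrow>
     complex^('x::finite \<times> 'x)^('x \<times> 'x) \<Rightarrow> complex^('z \<times> 2)^('z \<times> 2)" where
  "Xi A0 A1 X = Phi_A A0 A1 (ptrace_snd X) - Phi_B A0 A1 (ptrace_fst X)"


(* For Hermiticity-preserving linear \<Phi> the pairing is real; both extrema are attained by
   compactness, so this is min max. *)
definition equilibrium_value :: "(complex^'n^'n \<Rightarrow> complex^'m^'m) \<Rightarrow> real" where
  "equilibrium_value \<Phi> =
     (INF \<rho>\<in>density_ops. SUP P\<in>measurement_ops. Re (hs_inner P (\<Phi> \<rho>)))"


(* The library's exp needs a Banach algebra, which complex^'n^'n under ** is not declared to be. *)
definition mexp :: "complex^'n^'n \<Rightarrow> complex^'n^'n" where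
  "mexp A = (\<Sum>k. (1 / fact k) *\<^sub>R (((**) A ^^ k) (mat 1)))"

definition positive_eigenspace :: "complex^'n^'n \<Rightarrow> (complex^'n) set" where
  "positive_eigenspace H = vec.span {v. \<exists>c::real. 0 < c \<and> H *v v = complex_of_real c *s v}"

definition orth_proj :: "(complex^'n) set \<Rightarrow> complex^'n^'n" where
  "orth_proj S = (THE P. \<forall>v. P *v v \<in> S \<and> (\<forall>u\<in>S. cdot u (v - P *v v) = 0))"

end

(*
  W^(t+1) is the Gibbs operator of - eps (M^(1) + ... + M^(t)); the change of its trace in one step
  is controlled by comparing two Hermitian matrices in their two eigenbases, which yields
  Tr W^(t+1) <= (1 - eps <M^(t), rho^(t)> + eps^2) Tr W^(t). On the other hand
  exp <H, sigma> <= Tr exp H for every density operator sigma. Together these bound the regret of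
  the iterates against each fixed sigma by ln N / eps + eps T. Since Pi^(t) is a best response to
  rho^(t), each summand of lambda is at least the equilibrium value; conversely, the
  average payoff of the Pi^(t) against a fixed sigma never exceeds that of a best response to
  sigma, so the regret bound gives lambda - delta <= max_Pi <Pi, Xi sigma> for every sigma.
  The minimax theorem is not needed.
*)
theory Submission imports Defs begin

section \<open>Self-adjoint maps on Euclidean spaces\<close>

text \<open>\<open>complex^'n\<close> is treated as a real Euclidean space whose inner product is
  the real part of \<open>cdot\<close>. The Hermitian matrices are exactly those acting
  self-adjointly there, so one real spectral theorem serves throughout. Each complex dimension
  counts twice in a real basis, hence the factors 1/2 in the trace formulas. The obstacle is that a
  new loss operator need not commute with the earlier ones, so the exponential does not factor over
  a step. The squared overlaps \<open>(b \<bullet> d)\<^sup>2\<close> of two orthonormal bases have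
  row and column sums 1, which reduces each trace comparison to a scalar inequality for exp at a
  pair of eigenvalues. These hold for all reals, so \<open>\<delta>\<close> may be large. Constants:
  against a density operator the payoff is twice the loss minus 1, so payoff regret is twice loss
  regret. The average loss regret is at most \<open>ln N / (\<epsilon> T) + \<epsilon>\<close>; the
  choice of \<open>T\<close> makes the first term at most \<open>\<epsilon>\<close>, and doubling
  gives \<open>4 \<epsilon> = \<delta>\<close>.\<close>

definition orthonormal_basis :: "'a::euclidean_space set \<Rightarrow> bool" where
  "orthonormal_basis B \<longleftrightarrow>
     finite B \<and> pairwise orthogonal B \<and> (\<forall>b\<in>B. norm b = 1) \<and> span B = UNIV"

definition selfadjoint :: "('a::euclidean_space \<Rightarrow> 'a) \<Rightarrow> bool" where
  "selfadjoint f \<longleftrightarrow> linear f \<and> (\<forall>x y. x \<bullet> f y = f x \<bullet> y)"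

text \<open>The eigenvalue of a unit vector \<open>b\<close> is recovered as
  \<open>b \<bullet> f b\<close>, so no separate spectrum function has to be carried along.\<close>

definition eigenbasis :: "('a::euclidean_space \<Rightarrow> 'a) \<Rightarrow> 'a set \<Rightarrow> bool" where
  "eigenbasis f B \<longleftrightarrow> orthonormal_basis B \<and> (\<forall>b\<in>B. f b = (b \<bullet> f b) *\<^sub>R b)"

lemma orthonormal_basis_sum:
  assumes "orthonormal_basis B"
  shows "(\<Sum>b\<in>B. (x \<bullet> b) *\<^sub>R b) = x"
  using assms orthonormal_basis_expand[of B x] by (auto simp: orthonormal_basis_def)

lemma orthonormal_basis_inner:
  assumes "orthonormal_basis B"
  shows "x \<bullet> y = (\<Sum>b\<in>B. (x \<bullet> b) * (y \<bullet> b))"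
proof -
  have "x \<bullet> y = (\<Sum>b\<in>B. (x \<bullet> b) *\<^sub>R b) \<bullet> y"
    using orthonormal_basis_sum[OF assms] by simp
  also have "\<dots> = (\<Sum>b\<in>B. (x \<bullet> b) * (b \<bullet> y))"
    by (simp add: inner_sum_left)
  finally show ?thesis
    by (simp only: inner_commute[of _ y])
qed

lemma orthonormal_basis_sum_sq:
  assumes "orthonormal_basis B" "norm x = 1"
  shows "(\<Sum>b\<in>B. (x \<bullet> b)\<^sup>2) = 1"
  using orthonormal_basis_inner[OF assms(1), of x x] assms(2)
  by (simp add: power2_eq_square norm_eq_1)

text \<open>After expanding in \<open>C\<close> and exchanging the sums, the expansion in
  \<open>B\<close> reassembles each \<open>c\<close> inside \<open>f\<close>. This links sums over
  an eigenbasis to sums of diagonal entries.\<close>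

lemma orthonormal_basis_trace:
  assumes B: "orthonormal_basis B" and C: "orthonormal_basis C" and f: "linear f"
  shows "(\<Sum>b\<in>B. b \<bullet> f b) = (\<Sum>c\<in>C. c \<bullet> f c)"
proof -
  have "(\<Sum>b\<in>B. b \<bullet> f b) = (\<Sum>b\<in>B. \<Sum>c\<in>C. (b \<bullet> c) * (f b \<bullet> c))"
    by (simp add: orthonormal_basis_inner[OF C, symmetric])
  also have "\<dots> = (\<Sum>c\<in>C. \<Sum>b\<in>B. (b \<bullet> c) * (f b \<bullet> c))"
    by (rule sum.swap)
  also have "\<dots> = (\<Sum>c\<in>C. f (\<Sum>b\<in>B. (c \<bullet> b) *\<^sub>R b) \<bullet> c)"
    by (simp add: linear_sum[OF f] linear_cmul[OF f] inner_sum_left inner_sum_right inner_commute)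
  also have "\<dots> = (\<Sum>c\<in>C. c \<bullet> f c)"
    by (simp add: orthonormal_basis_sum[OF B] inner_commute)
  finally show ?thesis .
qed

text \<open>A maximiser \<open>v\<close> of the quadratic form on the unit sphere of
  \<open>S\<close> is an eigenvector. Invariance of \<open>S\<close> keeps the residual
  \<open>f v - l v\<close> in \<open>S\<close>, so \<open>v\<close> may be perturbed in that
  direction.\<close>

lemma selfadjoint_eigenvector:
  fixes f :: "'a::euclidean_space \<Rightarrow> 'a"
  assumes f: "selfadjoint f" and S: "subspace S" "f ` S \<subseteq> S" and ne: "S \<noteq> {0}"
  obtains v where "v \<in> S" "norm v = 1" "f v = (v \<bullet> f v) *\<^sub>R v"
proof -
  have lin: "linear f" and sym: "\<And>x y. x \<bullet> f y = f x \<bullet> y"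
    using f by (auto simp: selfadjoint_def)
  let ?K = "S \<inter> sphere 0 1"
  have "compact ?K"
    by (simp add: closed_subspace S closed_Int_compact)
  moreover have "?K \<noteq> {}"
  proof -
    obtain x where x: "x \<in> S" "x \<noteq> 0"
      using ne subspace_0[OF S(1)] by auto
    then have "x /\<^sub>R norm x \<in> ?K"
      by (simp add: subspace_scale[OF S(1)])
    then show ?thesis by blast
  qed
  moreover have "continuous_on ?K (\<lambda>x. x \<bullet> f x)"
    by (intro continuous_intros linear_continuous_on linear_conv_bounded_linear[THEN iffD1] lin)
  ultimately obtain v where v: "v \<in> ?K" and max: "\<And>x. x \<in> ?K \<Longrightarrow> x \<bullet> f x \<le> v \<bullet> f v"
    using continuous_attains_sup by metis
  define l where "l = v \<bullet> f v"
  have le: "x \<bullet> f x \<le> l * (x \<bullet> x)" if "x \<in> S" for x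
  proof (cases "x = 0")
    case False
    then have "x /\<^sub>R norm x \<in> ?K"
      using that by (simp add: subspace_scale[OF S(1)])
    from max[OF this] have "(x \<bullet> f x) / (norm x)\<^sup>2 \<le> l"
      by (simp add: linear_cmul[OF lin] l_def divide_inverse power2_eq_square mult_ac)
    then show ?thesis
      using False by (simp add: divide_simps dot_square_norm)
  qed (simp add: linear_0[OF lin])
  define r where "r = f v - l *\<^sub>R v"
  have vS: "v \<in> S" and vv: "v \<bullet> v = 1"
    using v by (auto simp: norm_eq_1)
  have rS: "r \<in> S"
    unfolding r_def using vS S by (intro subspace_diff subspace_scale) auto
  define k where "k = l * (r \<bullet> r) - r \<bullet> f r"
  have rfv: "r \<bullet> f v = r \<bullet> r + l * (r \<bullet> v)"
    by (simp add: r_def inner_diff_right)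
  \<comment> \<open>Maximality tested at \<open>v + t r\<close>: the gain is of first order in
    \<open>t\<close> and the slack of second order, so a small positive \<open>t\<close> forces
    \<open>r = 0\<close>.\<close>
  have q: "2 * t * (r \<bullet> r) \<le> t\<^sup>2 * k" for t
  proof -
    have "v + t *\<^sub>R r \<in> S"
      using vS rS S by (intro subspace_add subspace_scale)
    from le[OF this] have "l + 2 * t * (r \<bullet> f v) + t\<^sup>2 * (r \<bullet> f r)
        \<le> l * (1 + 2 * t * (r \<bullet> v) + t\<^sup>2 * (r \<bullet> r))"
      using sym[of v r]
      by (simp add: linear_add[OF lin] linear_cmul[OF lin] inner_add_left inner_add_right
          vv l_def inner_commute power2_eq_square algebra_simps)
    then show ?thesis
      unfolding rfv k_def by (simp add: algebra_simps)
  qed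
  have "r \<bullet> r = 0"
  proof (rule ccontr)
    assume "r \<bullet> r \<noteq> 0"
    then have p: "r \<bullet> r > 0" by simp
    \<comment> \<open>With this \<open>t\<close>, \<open>t * k\<close> is at most
      \<open>r \<bullet> r\<close>, half of what \<open>q\<close> demands; the \<open>+ 1\<close>
      keeps the denominator positive.\<close>
    define t where "t = (r \<bullet> r) / (\<bar>k\<bar> + 1)"
    have t: "t > 0" "t * (\<bar>k\<bar> + 1) = r \<bullet> r"
      using p by (auto simp: t_def divide_simps)
    have "2 * (r \<bullet> r) \<le> t * k"
      using q[of t] t(1) by (simp add: power2_eq_square algebra_simps)
    also have "\<dots> \<le> t * (\<bar>k\<bar> + 1)"
      using t(1) by (intro mult_left_mono) auto
    finally show False using t(2) p by simp
  qed
  then have "f v = (v \<bullet> f v) *\<^sub>R v"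
    by (simp add: r_def l_def)
  then show thesis using that vS v by auto
qed

text \<open>Take an orthonormal set of eigenvectors of greatest cardinality. Its orthogonal
  complement is invariant, so a nonzero complement would supply one more eigenvector.\<close>

lemma selfadjoint_eigenbasis:
  fixes f :: "'a::euclidean_space \<Rightarrow> 'a"
  assumes f: "selfadjoint f"
  obtains B where "eigenbasis f B"
proof -
  have lin: "linear f" and sym: "\<And>x y. x \<bullet> f y = f x \<bullet> y"
    using f by (auto simp: selfadjoint_def)
  define Q where "Q B \<longleftrightarrow> finite B \<and> pairwise orthogonal B \<and> (\<forall>b\<in>B. norm b = 1) \<and>
    (\<forall>b\<in>B. f b = (b \<bullet> f b) *\<^sub>R b)" for B
  have bound: "card B \<le> DIM('a)" if "Q B" for B
    using that pairwise_orthogonal_independent[of B] independent_bound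
    unfolding Q_def by force
  have "Q {}" by (simp add: Q_def)
  then obtain B where B: "Q B" and max: "\<And>C. Q C \<Longrightarrow> card C \<le> card B"
    using ex_has_greatest_nat[of Q "{}" card "Suc (DIM('a))"] bound by (auto simp: less_Suc_eq_le)
  have "span B = UNIV"
  proof (rule ccontr)
    assume "span B \<noteq> UNIV"
    then obtain a where a: "a \<noteq> 0" "\<forall>x\<in>span B. a \<bullet> x = 0"
      using span_not_UNIV_orthogonal by blast
    define S where "S = {x. \<forall>b\<in>B. b \<bullet> x = 0}"
    have "subspace S"
      by (auto simp: S_def subspace_def inner_add_right)
    moreover have "f ` S \<subseteq> S"
    proof (clarsimp simp: S_def)
      fix x b assume *: "\<forall>b\<in>B. b \<bullet> x = 0" and b: "b \<in> B"
      have "f b = (b \<bullet> f b) *\<^sub>R b"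
        using B b by (auto simp: Q_def)
      then have "f b \<bullet> x = (b \<bullet> f b) * (b \<bullet> x)"
        by (metis inner_scaleR_left)
      then show "b \<bullet> f x = 0"
        using * b by (simp add: sym)
    qed
    moreover have "S \<noteq> {0}"
      using a by (auto simp: S_def span_base inner_commute)
    ultimately obtain v where v: "v \<in> S" "norm v = 1" "f v = (v \<bullet> f v) *\<^sub>R v"
      using selfadjoint_eigenvector[OF f] by blast
    have "v \<notin> B"
      using v(1,2) by (auto simp: S_def)
    have "Q (insert v B)"
      using B v by (auto simp: Q_def S_def pairwise_insert orthogonal_def inner_commute)
    from max[OF this] show False
      using \<open>v \<notin> B\<close> B by (simp add: Q_def)
  qed
  then show thesis
    using that B by (auto simp: Q_def eigenbasis_def orthonormal_basis_def)
qed

lemma eigenbasis_coordinate: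
  assumes "selfadjoint f" "eigenbasis f B" and b: "b \<in> B"
  shows "f x \<bullet> b = (b \<bullet> f b) * (x \<bullet> b)"
proof -
  have "f b = (b \<bullet> f b) *\<^sub>R b"
    using assms(2) b by (simp add: eigenbasis_def)
  then have "x \<bullet> f b = (b \<bullet> f b) * (x \<bullet> b)"
    by (metis inner_scaleR_right)
  then show ?thesis
    using assms(1) by (simp add: selfadjoint_def)
qed

lemma eigenbasis_quadratic_form:
  assumes "selfadjoint f" "eigenbasis f B"
  shows "x \<bullet> f x = (\<Sum>b\<in>B. (b \<bullet> f b) * (x \<bullet> b)\<^sup>2)"
proof -
  have "f x \<bullet> x = (\<Sum>b\<in>B. (f x \<bullet> b) * (x \<bullet> b))"
    using assms by (intro orthonormal_basis_inner) (simp add: eigenbasis_def)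
  also have "\<dots> = (\<Sum>b\<in>B. (b \<bullet> f b) * (x \<bullet> b)\<^sup>2)"
    by (intro sum.cong) (simp_all add: eigenbasis_coordinate[OF assms] power2_eq_square)
  finally show ?thesis by (simp add: inner_commute)
qed

text \<open>Meant for an eigenvector \<open>x\<close> of a second map with eigenvalue
  \<open>a\<close>: the left side is then the squared norm of the difference of the two maps at
  \<open>x\<close>.\<close>

lemma eigenbasis_norm_shift:
  assumes "selfadjoint f" "eigenbasis f B"
  shows "(norm (f x - a *\<^sub>R x))\<^sup>2 = (\<Sum>b\<in>B. (b \<bullet> f b - a)\<^sup>2 * (x \<bullet> b)\<^sup>2)"
proof -
  have "(norm (f x - a *\<^sub>R x))\<^sup>2 = (\<Sum>b\<in>B. ((f x - a *\<^sub>R x) \<bullet> b) * ((f x - a *\<^sub>R x) \<bullet> b))"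
    using assms orthonormal_basis_inner[of B "f x - a *\<^sub>R x" "f x - a *\<^sub>R x"]
    by (simp add: eigenbasis_def dot_square_norm)
  also have "\<dots> = (\<Sum>b\<in>B. (b \<bullet> f b - a)\<^sup>2 * (x \<bullet> b)\<^sup>2)"
    by (intro sum.cong)
      (simp_all add: eigenbasis_coordinate[OF assms] inner_diff_left power2_eq_square algebra_simps)
  finally show ?thesis .
qed

text \<open>All eigenvalues lie in \<open>[0, 1]\<close>, hence so do their squares. For a loss
  operator this controls the second-order term of one update.\<close>

lemma selfadjoint_contraction:
  assumes f: "selfadjoint f" and nonneg: "\<And>x. 0 \<le> x \<bullet> f x" and le: "\<And>x. x \<bullet> f x \<le> x \<bullet> x"
  shows "(norm (f x))\<^sup>2 \<le> x \<bullet> x"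
proof -
  obtain B where B: "eigenbasis f B"
    using selfadjoint_eigenbasis[OF f] .
  have "(norm (f x))\<^sup>2 = (\<Sum>b\<in>B. (b \<bullet> f b)\<^sup>2 * (x \<bullet> b)\<^sup>2)"
    using eigenbasis_norm_shift[OF f B, of x 0] by simp
  also have "\<dots> \<le> (\<Sum>b\<in>B. (x \<bullet> b)\<^sup>2)"
  proof (rule sum_mono)
    fix b assume "b \<in> B"
    then have "b \<bullet> b = 1"
      using B by (auto simp: eigenbasis_def orthonormal_basis_def norm_eq_1)
    then have "(b \<bullet> f b)\<^sup>2 \<le> 1"
      using nonneg[of b] le[of b] by (simp add: power_le_one)
    then show "(b \<bullet> f b)\<^sup>2 * (x \<bullet> b)\<^sup>2 \<le> (x \<bullet> b)\<^sup>2"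
      using mult_right_mono[of "(b \<bullet> f b)\<^sup>2" 1 "(x \<bullet> b)\<^sup>2"] by simp
  qed
  also have "\<dots> = x \<bullet> x"
    using orthonormal_basis_inner[of B x x] B by (simp add: eigenbasis_def power2_eq_square)
  finally show ?thesis .
qed

text \<open>Converse of the spectral theorem. It gives self-adjointness of \<open>mexp A\<close> and
  of the projection from their action on an eigenbasis alone.\<close>

lemma diagonal_selfadjoint:
  assumes F: "linear F" and B: "orthonormal_basis B" and e: "\<And>b. b \<in> B \<Longrightarrow> F b = e b *\<^sub>R b"
  shows "selfadjoint F" "eigenbasis F B" "\<And>b. b \<in> B \<Longrightarrow> b \<bullet> F b = e b"
proof -
  have "b \<bullet> b = 1" if "b \<in> B" for b
    using that B by (auto simp: orthonormal_basis_def norm_eq_1)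
  then show be: "b \<bullet> F b = e b" if "b \<in> B" for b
    using that by (simp add: e)
  then show "eigenbasis F B"
    using B e by (simp add: eigenbasis_def)
  have "F y = (\<Sum>b\<in>B. (y \<bullet> b) *\<^sub>R e b *\<^sub>R b)" for y
  proof -
    have "F y = F (\<Sum>b\<in>B. (y \<bullet> b) *\<^sub>R b)"
      by (simp add: orthonormal_basis_sum[OF B])
    also have "\<dots> = (\<Sum>b\<in>B. (y \<bullet> b) *\<^sub>R F b)"
      by (simp add: linear_sum[OF F] linear_cmul[OF F])
    finally show ?thesis by (simp add: e)
  qed
  then have "x \<bullet> F y = (\<Sum>b\<in>B. e b * (x \<bullet> b) * (y \<bullet> b))" for x y
    by (simp add: inner_sum_right mult_ac)
  then have "x \<bullet> F y = y \<bullet> F x" for x y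
    by (simp add: mult_ac)
  then show "selfadjoint F"
    using F by (simp add: selfadjoint_def inner_commute)
qed

section \<open>Comparing traces of exponentials\<close>

text \<open>The remainder carries both \<open>exp y\<close> and \<open>exp x\<close> so that, after
  summation over two eigenbases, each half is a trace weighted in its own basis. Dividing by
  \<open>exp y\<close> leaves an inequality in \<open>d = x - y\<close>.\<close>

lemma exp_second_order_upper:
  fixes x y :: real
  shows "exp x \<le> exp y * (1 + (x - y)) + (x - y)\<^sup>2 * (exp y + exp x) / 2"
proof -
  have "exp d \<le> 1 + d + d\<^sup>2 * (1 + exp d) / 2" for d :: real
  proof (cases "0 \<le> d")
    case True
    obtain t where t: "\<bar>t\<bar> \<le> \<bar>d\<bar>" "exp d = (\<Sum>m<2. d ^ m / fact m) + exp t / fact 2 * d\<^sup>2"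
      using Maclaurin_exp_le[of d 2] by blast
    have "exp t * d\<^sup>2 \<le> (1 + exp d) * d\<^sup>2"
      using t(1) True by (intro mult_right_mono add_increasing) auto
    then show ?thesis
      using t(2) by (simp add: numeral_2_eq_2 algebra_simps)
  next
    case False
    \<comment> \<open>For negative \<open>d\<close> the quadratic lower bound on
      \<open>exp s\<close> is inverted: its product with \<open>1 - s + s\<^sup>2 / 2\<close> is at
      least 1.\<close>
    define s where "s = - d"
    have s: "0 \<le> s" using False by (simp add: s_def)
    have "(1 + s + s\<^sup>2 / 2) * (1 - s + s\<^sup>2 / 2) = 1 + (s\<^sup>2 / 2)\<^sup>2"
      by (simp add: algebra_simps power2_eq_square)
    then have "1 \<le> (1 + s + s\<^sup>2 / 2) * (1 - s + s\<^sup>2 / 2)"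
      by simp
    also have "\<dots> \<le> exp s * (1 - s + s\<^sup>2 / 2)"
    proof (rule mult_right_mono[OF exp_lower_Taylor_quadratic[OF s]])
      have "0 \<le> (s - 1)\<^sup>2 + 1" by simp
      then show "0 \<le> 1 - s + s\<^sup>2 / 2" by (simp add: power2_eq_square algebra_simps)
    qed
    finally have "exp d \<le> 1 + d + d\<^sup>2 / 2"
      by (simp add: s_def exp_minus divide_simps)
    also have "\<dots> \<le> 1 + d + d\<^sup>2 * (1 + exp d) / 2"
      by (simp add: algebra_simps)
    finally show ?thesis .
  qed
  then have "exp y * exp (x - y) \<le> exp y * (1 + (x - y) + (x - y)\<^sup>2 * (1 + exp (x - y)) / 2)"
    by (intro mult_left_mono) auto
  also have "\<dots> = exp y * (1 + (x - y)) + (x - y)\<^sup>2 * (exp y + exp y * exp (x - y)) / 2"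
    by (simp add: algebra_simps add_divide_distrib)
  finally show ?thesis
    by (simp add: exp_add[symmetric])
qed

text \<open>The exponential is not operator monotone, but its trace is. The tangent to exp at each
  eigenvalue of \<open>g\<close> lies below exp at every eigenvalue of \<open>f\<close>, and
  averaging with the weights \<open>(d \<bullet> b)\<^sup>2\<close> keeps the inequality.\<close>

lemma trace_exp_mono:
  assumes f: "selfadjoint f" and B: "eigenbasis f B"
    and g: "selfadjoint g" and D: "eigenbasis g D"
    and le: "\<And>x. x \<bullet> g x \<le> x \<bullet> f x"
  shows "(\<Sum>d\<in>D. exp (d \<bullet> g d)) \<le> (\<Sum>b\<in>B. exp (b \<bullet> f b))"
proof -
  have oB: "orthonormal_basis B" and oD: "orthonormal_basis D"
    using B D by (auto simp: eigenbasis_def)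
  have nB: "norm b = 1" if "b \<in> B" for b using that oB by (simp add: orthonormal_basis_def)
  have nD: "norm d = 1" if "d \<in> D" for d using that oD by (simp add: orthonormal_basis_def)
  have "(\<Sum>d\<in>D. exp (d \<bullet> g d)) \<le> (\<Sum>d\<in>D. exp (d \<bullet> g d) * (1 + (d \<bullet> f d - d \<bullet> g d)))"
    using le by (intro sum_mono) simp
  also have "\<dots> = (\<Sum>d\<in>D. \<Sum>b\<in>B. exp (d \<bullet> g d) * (1 + (b \<bullet> f b - d \<bullet> g d)) * (d \<bullet> b)\<^sup>2)"
  proof (rule sum.cong)
    fix d assume d: "d \<in> D"
    have "(\<Sum>b\<in>B. exp (d \<bullet> g d) * (1 + (b \<bullet> f b - d \<bullet> g d)) * (d \<bullet> b)\<^sup>2)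
        = exp (d \<bullet> g d) * ((1 - d \<bullet> g d) * (\<Sum>b\<in>B. (d \<bullet> b)\<^sup>2) + (\<Sum>b\<in>B. (b \<bullet> f b) * (d \<bullet> b)\<^sup>2))"
      by (simp add: sum_distrib_left sum.distrib[symmetric] algebra_simps)
    then show "exp (d \<bullet> g d) * (1 + (d \<bullet> f d - d \<bullet> g d)) =
        (\<Sum>b\<in>B. exp (d \<bullet> g d) * (1 + (b \<bullet> f b - d \<bullet> g d)) * (d \<bullet> b)\<^sup>2)"
      by (simp add: eigenbasis_quadratic_form[OF f B, of d] orthonormal_basis_sum_sq[OF oB nD[OF d]])
  qed simp
  also have "\<dots> \<le> (\<Sum>d\<in>D. \<Sum>b\<in>B. exp (b \<bullet> f b) * (d \<bullet> b)\<^sup>2)"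
  proof (intro sum_mono mult_right_mono)
    fix d b
    have "1 + (b \<bullet> f b - d \<bullet> g d) \<le> exp (b \<bullet> f b - d \<bullet> g d)"
      by (rule exp_ge_add_one_self)
    then have "exp (d \<bullet> g d) * (1 + (b \<bullet> f b - d \<bullet> g d)) \<le> exp (d \<bullet> g d) * exp (b \<bullet> f b - d \<bullet> g d)"
      by (intro mult_left_mono) auto
    then show "exp (d \<bullet> g d) * (1 + (b \<bullet> f b - d \<bullet> g d)) \<le> exp (b \<bullet> f b)"
      by (simp add: exp_add[symmetric])
  qed auto
  also have "\<dots> = (\<Sum>b\<in>B. exp (b \<bullet> f b) * (\<Sum>d\<in>D. (b \<bullet> d)\<^sup>2))"
    by (subst sum.swap) (simp add: sum_distrib_left inner_commute)
  also have "\<dots> = (\<Sum>b\<in>B. exp (b \<bullet> f b))"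
    by (simp add: orthonormal_basis_sum_sq[OF oD nB])
  finally show ?thesis .
qed

text \<open>
  Expanding in the two eigenbases turns every trace below into a sum over pairs weighted by
  \<open>(b \<bullet> d)\<^sup>2\<close>, so the operator inequality reduces to \<open>exp_second_order_upper\<close> termwise.
\<close>

lemma trace_exp_second_order:
  assumes f: "selfadjoint f" and B: "eigenbasis f B"
    and g: "selfadjoint g" and D: "eigenbasis g D"
  shows "(\<Sum>d\<in>D. exp (d \<bullet> g d)) \<le> (\<Sum>b\<in>B. exp (b \<bullet> f b) * (1 + b \<bullet> (g b - f b)))
     + ((\<Sum>b\<in>B. exp (b \<bullet> f b) * (norm (g b - f b))\<^sup>2)
        + (\<Sum>d\<in>D. exp (d \<bullet> g d) * (norm (g d - f d))\<^sup>2)) / 2"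
proof -
  have oB: "orthonormal_basis B" and oD: "orthonormal_basis D"
    using B D by (auto simp: eigenbasis_def)
  have nB: "norm b = 1" if "b \<in> B" for b using that oB by (simp add: orthonormal_basis_def)
  have nD: "norm d = 1" if "d \<in> D" for d using that oD by (simp add: orthonormal_basis_def)
  have fb: "f b = (b \<bullet> f b) *\<^sub>R b" if "b \<in> B" for b using that B by (simp add: eigenbasis_def)
  have gd: "g d = (d \<bullet> g d) *\<^sub>R d" if "d \<in> D" for d using that D by (simp add: eigenbasis_def)
  have 0: "(\<Sum>b\<in>B. \<Sum>d\<in>D. exp (d \<bullet> g d) * (b \<bullet> d)\<^sup>2) = (\<Sum>d\<in>D. exp (d \<bullet> g d))"
    by (subst sum.swap)
      (simp add: sum_distrib_left[symmetric] inner_commute[of _ "_ :: 'a"] orthonormal_basis_sum_sq[OF oB nD])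
  have 1: "(\<Sum>b\<in>B. \<Sum>d\<in>D. exp (b \<bullet> f b) * (1 + (d \<bullet> g d - b \<bullet> f b)) * (b \<bullet> d)\<^sup>2)
      = (\<Sum>b\<in>B. exp (b \<bullet> f b) * (1 + b \<bullet> (g b - f b)))"
  proof (rule sum.cong)
    fix b assume b: "b \<in> B"
    have "(\<Sum>d\<in>D. exp (b \<bullet> f b) * (1 + (d \<bullet> g d - b \<bullet> f b)) * (b \<bullet> d)\<^sup>2)
        = exp (b \<bullet> f b) * ((1 - b \<bullet> f b) * (\<Sum>d\<in>D. (b \<bullet> d)\<^sup>2) + (\<Sum>d\<in>D. (d \<bullet> g d) * (b \<bullet> d)\<^sup>2))"
      by (simp add: sum_distrib_left sum.distrib[symmetric] algebra_simps)
    then show "(\<Sum>d\<in>D. exp (b \<bullet> f b) * (1 + (d \<bullet> g d - b \<bullet> f b)) * (b \<bullet> d)\<^sup>2)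
        = exp (b \<bullet> f b) * (1 + b \<bullet> (g b - f b))"
      by (simp add: eigenbasis_quadratic_form[OF g D, of b] orthonormal_basis_sum_sq[OF oD nB[OF b]]
          inner_diff_right)
  qed simp
  have 2: "(\<Sum>b\<in>B. \<Sum>d\<in>D. exp (b \<bullet> f b) * (d \<bullet> g d - b \<bullet> f b)\<^sup>2 * (b \<bullet> d)\<^sup>2)
      = (\<Sum>b\<in>B. exp (b \<bullet> f b) * (norm (g b - f b))\<^sup>2)"
  proof (rule sum.cong)
    fix b assume b: "b \<in> B"
    show "(\<Sum>d\<in>D. exp (b \<bullet> f b) * (d \<bullet> g d - b \<bullet> f b)\<^sup>2 * (b \<bullet> d)\<^sup>2)
        = exp (b \<bullet> f b) * (norm (g b - f b))\<^sup>2"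
      using eigenbasis_norm_shift[OF g D, of b "b \<bullet> f b"] fb[OF b]
      by (simp add: sum_distrib_left mult.assoc)
  qed simp
  \<comment> \<open>Here the exponential weight belongs to \<open>d\<close>, so the sum over
    \<open>b\<close> is taken first and the roles of \<open>f\<close> and \<open>g\<close> are
    exchanged; squaring absorbs the sign.\<close>
  have 3: "(\<Sum>b\<in>B. \<Sum>d\<in>D. exp (d \<bullet> g d) * (d \<bullet> g d - b \<bullet> f b)\<^sup>2 * (b \<bullet> d)\<^sup>2)
      = (\<Sum>d\<in>D. exp (d \<bullet> g d) * (norm (g d - f d))\<^sup>2)"
  proof (subst sum.swap, rule sum.cong)
    fix d assume d: "d \<in> D"
    show "(\<Sum>b\<in>B. exp (d \<bullet> g d) * (d \<bullet> g d - b \<bullet> f b)\<^sup>2 * (b \<bullet> d)\<^sup>2)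
        = exp (d \<bullet> g d) * (norm (g d - f d))\<^sup>2"
      using eigenbasis_norm_shift[OF f B, of d "d \<bullet> g d"] gd[OF d]
      by (simp add: sum_distrib_left mult.assoc inner_commute norm_minus_commute power2_commute)
  qed simp
  have "(\<Sum>b\<in>B. \<Sum>d\<in>D. exp (d \<bullet> g d) * (b \<bullet> d)\<^sup>2)
      \<le> (\<Sum>b\<in>B. \<Sum>d\<in>D. exp (b \<bullet> f b) * (1 + (d \<bullet> g d - b \<bullet> f b)) * (b \<bullet> d)\<^sup>2
          + (exp (b \<bullet> f b) * (d \<bullet> g d - b \<bullet> f b)\<^sup>2 * (b \<bullet> d)\<^sup>2
             + exp (d \<bullet> g d) * (d \<bullet> g d - b \<bullet> f b)\<^sup>2 * (b \<bullet> d)\<^sup>2) / 2)"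
  proof (intro sum_mono)
    fix b d
    show "exp (d \<bullet> g d) * (b \<bullet> d)\<^sup>2
      \<le> exp (b \<bullet> f b) * (1 + (d \<bullet> g d - b \<bullet> f b)) * (b \<bullet> d)\<^sup>2
          + (exp (b \<bullet> f b) * (d \<bullet> g d - b \<bullet> f b)\<^sup>2 * (b \<bullet> d)\<^sup>2
             + exp (d \<bullet> g d) * (d \<bullet> g d - b \<bullet> f b)\<^sup>2 * (b \<bullet> d)\<^sup>2) / 2"
      using mult_right_mono[OF exp_second_order_upper[of "d \<bullet> g d" "b \<bullet> f b"], of "(b \<bullet> d)\<^sup>2"]
      by (simp add: algebra_simps add_divide_distrib)
  qed
  then show ?thesis
    unfolding sum.distrib sum_divide_distrib[symmetric] 0 1 2 3 .
qed

text \<open>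
  Monotonicity of the trace exponential bounds the second-order
  term at \<open>f - \<epsilon> h\<close> by the one at \<open>f\<close>. This replaces the Golden--Thompson inequality.
\<close>

lemma trace_exp_step:
  assumes f: "selfadjoint f" and B: "eigenbasis f B"
    and g: "selfadjoint g" and D: "eigenbasis g D"
    and h: "selfadjoint h" "\<And>x. 0 \<le> x \<bullet> h x" "\<And>x. x \<bullet> h x \<le> x \<bullet> x"
    and gh: "\<And>x. g x = f x - \<epsilon> *\<^sub>R h x" and \<epsilon>: "0 \<le> \<epsilon>"
  shows "(\<Sum>d\<in>D. exp (d \<bullet> g d))
    \<le> (1 + \<epsilon>\<^sup>2) * (\<Sum>b\<in>B. exp (b \<bullet> f b)) - \<epsilon> * (\<Sum>b\<in>B. exp (b \<bullet> f b) * (b \<bullet> h b))"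
proof -
  let ?Zf = "\<Sum>b\<in>B. exp (b \<bullet> f b)" and ?Zg = "\<Sum>d\<in>D. exp (d \<bullet> g d)"
  have mono: "?Zg \<le> ?Zf"
    using trace_exp_mono[OF f B g D] h(2) \<epsilon> by (simp add: gh inner_diff_right)
  have sq: "(norm (g x - f x))\<^sup>2 \<le> \<epsilon>\<^sup>2" if "norm x = 1" for x
  proof -
    have "(norm (h x))\<^sup>2 \<le> 1"
      using selfadjoint_contraction[OF h, of x] that by (simp add: norm_eq_1)
    then show ?thesis
      by (simp add: gh power_mult_distrib mult_left_le)
  qed
  have nB: "norm b = 1" if "b \<in> B" for b
    using that B by (simp add: eigenbasis_def orthonormal_basis_def)
  have nD: "norm d = 1" if "d \<in> D" for d
    using that D by (simp add: eigenbasis_def orthonormal_basis_def)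
  have Y: "(\<Sum>b\<in>B. exp (b \<bullet> f b) * (norm (g b - f b))\<^sup>2) \<le> ?Zf * \<epsilon>\<^sup>2"
    unfolding sum_distrib_right by (intro sum_mono mult_left_mono sq nB) auto
  have W: "(\<Sum>d\<in>D. exp (d \<bullet> g d) * (norm (g d - f d))\<^sup>2) \<le> ?Zf * \<epsilon>\<^sup>2"
  proof (rule order_trans)
    show "(\<Sum>d\<in>D. exp (d \<bullet> g d) * (norm (g d - f d))\<^sup>2) \<le> ?Zg * \<epsilon>\<^sup>2"
      unfolding sum_distrib_right by (intro sum_mono mult_left_mono sq nD) auto
    show "?Zg * \<epsilon>\<^sup>2 \<le> ?Zf * \<epsilon>\<^sup>2"
      using mono by (intro mult_right_mono) auto
  qed
  have X: "(\<Sum>b\<in>B. exp (b \<bullet> f b) * (1 + b \<bullet> (g b - f b)))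
      = ?Zf - \<epsilon> * (\<Sum>b\<in>B. exp (b \<bullet> f b) * (b \<bullet> h b))"
    by (simp add: gh sum_distrib_left sum_subtractf algebra_simps)
  have "z \<le> p + q" if "z \<le> p + (y + w) / 2" "y \<le> q" "w \<le> q" for p q w y z :: real
    using that by argo
  from this[OF trace_exp_second_order[OF f B g D] Y W] show ?thesis
    unfolding X by (simp add: distrib_right mult.commute)
qed

section \<open>Hermitian matrices\<close>

lemma inner_eq_Re_cdot: "u \<bullet> v = Re (cdot u v)"
  by (simp add: inner_vec_def cdot_def inner_complex_def)

text \<open>Complex orthogonality to \<open>u\<close> thus amounts to real orthogonality to both
  \<open>u\<close> and \<open>\<i> *s u\<close>.\<close>

lemma cdot_eq_inner: "cdot u v = Complex (u \<bullet> v) ((\<i> *s u) \<bullet> v)"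
  by (simp add: complex_eq_iff inner_vec_def cdot_def inner_complex_def)

lemma cdot_hadj: "cdot u (A *v w) = cdot (hadj A *v u) w"
  unfolding cdot_def hadj_def matrix_vector_mult_def
  by (simp add: sum_distrib_left sum_distrib_right mult_ac) (rule sum.swap)

lemma linear_matrix_vector_complex: "linear ((*v) (A :: complex^'n^'m))"
  by simp

text \<open>Bridge between the matrix notions and the real spectral theorem. The converse holds
  because the real inner product is already nondegenerate.\<close>

lemma hermitian_iff_selfadjoint: "hadj A = A \<longleftrightarrow> selfadjoint ((*v) (A :: complex^'n^'n))"
proof
  assume "hadj A = A"
  then show "selfadjoint ((*v) A)"
    by (simp add: selfadjoint_def inner_eq_Re_cdot cdot_hadj)
next
  assume A: "selfadjoint ((*v) A)"
  have "hadj A *v x = A *v x" for x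
  proof -
    have "(hadj A *v x) \<bullet> y = (A *v x) \<bullet> y" for y
      using A by (simp add: selfadjoint_def inner_eq_Re_cdot cdot_hadj[symmetric])
    then have "(hadj A *v x - A *v x) \<bullet> y = 0" for y
      by (simp add: inner_diff_left)
    then show ?thesis
      by (metis inner_eq_zero_iff right_minus_eq)
  qed
  then show "hadj A = A"
    by (simp add: matrix_eq)
qed

lemma psd_iff: "psd A \<longleftrightarrow> selfadjoint ((*v) A) \<and> (\<forall>v. 0 \<le> v \<bullet> (A *v v))"
  by (simp add: psd_def hermitian_iff_selfadjoint inner_eq_Re_cdot)

lemma hadj_add: "hadj (A + B) = hadj A + hadj B"
  and hadj_diff: "hadj (A - B) = hadj A - hadj B"
  and hadj_zero: "hadj 0 = 0"
  and hadj_mat_1: "hadj (mat 1) = mat 1"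
  and hadj_scaleR: "hadj (r *\<^sub>R A) = r *\<^sub>R hadj A"
  and hadj_hadj: "hadj (hadj A) = A"
  by (simp_all add: hadj_def vec_eq_iff mat_def)

lemma hadj_mult: "hadj (A ** B) = hadj B ** hadj A"
  by (simp add: hadj_def vec_eq_iff matrix_matrix_mult_def mult.commute)

lemma hadj_sum: "hadj (sum f I) = (\<Sum>i\<in>I. hadj (f i))"
  by (induction I rule: infinite_finite_induct) (simp_all add: hadj_zero hadj_add)

lemma hs_inner_eq_sum: "hs_inner A B = (\<Sum>i\<in>UNIV. \<Sum>j\<in>UNIV. cnj (A $ j $ i) * B $ j $ i)"
  by (simp add: hs_inner_def trace_def matrix_matrix_mult_def hadj_def)

lemma hs_inner_hadj: "hs_inner (hadj A) (hadj B) = cnj (hs_inner A B)"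
  unfolding hs_inner_eq_sum by (simp add: hadj_def) (rule sum.swap)

lemma hs_inner_real:
  assumes "hadj A = A" "hadj B = B"
  shows "hs_inner A B = of_real (Re (hs_inner A B))"
  using hs_inner_hadj[of A B] assms by (simp add: complex_eq_iff)

lemma hs_inner_add_left: "hs_inner (A + B) X = hs_inner A X + hs_inner B X"
  and hs_inner_add_right: "hs_inner X (A + B) = hs_inner X A + hs_inner X B"
  and hs_inner_diff_left: "hs_inner (A - B) X = hs_inner A X - hs_inner B X"
  and hs_inner_diff_right: "hs_inner X (A - B) = hs_inner X A - hs_inner X B"
  and hs_inner_scaleR_left: "hs_inner (r *\<^sub>R A) X = r *\<^sub>R hs_inner A X"
  and hs_inner_scaleR_right: "hs_inner X (r *\<^sub>R A) = r *\<^sub>R hs_inner X A"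
  and hs_inner_zero_left: "hs_inner 0 X = 0"
  and hs_inner_cscale_right: "hs_inner X (cscale c A) = c * hs_inner X A"
  unfolding hs_inner_eq_sum
  by (simp_all add: cscale_def algebra_simps sum.distrib sum_subtractf sum_distrib_left scaleR_sum_right)

lemma hs_inner_sum_left: "hs_inner (sum f I) X = (\<Sum>i\<in>I. hs_inner (f i) X)"
  by (induction I rule: infinite_finite_induct) (simp_all add: hs_inner_zero_left hs_inner_add_left)

lemma hs_inner_sum_right: "hs_inner X (sum f I) = (\<Sum>i\<in>I. hs_inner X (f i))"
  by (induction I rule: infinite_finite_induct) (simp_all add: hs_inner_add_right, simp_all add: hs_inner_eq_sum)

lemma hs_inner_mat_1_left: "hs_inner (mat 1) X = trace X"
  by (simp add: hs_inner_def hadj_mat_1)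

lemma hs_inner_mat_1_right: "hs_inner X (mat 1) = trace (hadj X)"
  by (simp add: hs_inner_def)

section \<open>Traces and pairings in a real eigenbasis\<close>

lemma orthonormal_basis_Basis: "orthonormal_basis Basis"
  by (auto simp: orthonormal_basis_def pairwise_def orthogonal_def inner_Basis)

text \<open>A complex space of dimension \<open>n\<close> has real dimension \<open>2 n\<close>, whence the factor 1/2.\<close>

lemma Re_trace:
  fixes A :: "complex^'n^'n"
  assumes "orthonormal_basis B"
  shows "Re (trace A) = (\<Sum>b\<in>B. b \<bullet> (A *v b)) / 2"
proof -
  have diag: "(A *v axis i u) $ i = A $ i $ i * u" for i u
    by (simp add: matrix_vector_mult_def axis_def if_distrib cong: if_cong)
  let ?I = "UNIV \<times> {1, \<i>} :: ('n \<times> complex) set"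
  \<comment> \<open>Each coordinate \<open>i\<close> contributes the two real basis vectors
    \<open>axis i 1\<close> and \<open>axis i \<i>\<close>, and each of them yields
    \<open>Re (A $ i $ i)\<close>.\<close>
  have Basis: "(Basis :: (complex^'n) set) = (\<lambda>(i, u). axis i u) ` ?I"
    by (auto simp: Basis_vec_def Basis_complex_def)
  have inj: "inj_on (\<lambda>(i, u). axis i u :: complex^'n) ?I"
    by (auto simp: inj_on_def axis_eq_axis)
  have "(\<Sum>b\<in>B. b \<bullet> (A *v b)) = (\<Sum>b\<in>Basis. b \<bullet> (A *v b))"
    by (rule orthonormal_basis_trace[OF assms orthonormal_basis_Basis]) simp
  also have "\<dots> = (\<Sum>(i, u)\<in>?I. axis i u \<bullet> (A *v axis i u))"
    unfolding Basis by (subst sum.reindex[OF inj]) (simp add: case_prod_unfold)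
  also have "\<dots> = (\<Sum>i\<in>UNIV. \<Sum>u\<in>{1, \<i>}. axis i u \<bullet> (A *v axis i u))"
    by (simp only: sum.cartesian_product)
  also have "\<dots> = (\<Sum>i\<in>UNIV. 2 * Re (A $ i $ i))"
    by (simp add: inner_axis' diag inner_complex_def)
  finally show ?thesis
    by (simp add: trace_def sum_distrib_left[symmetric])
qed

text \<open>Reduces pairings to scalars: the eigenvalues of \<open>X\<close> weighted by the
  diagonal of \<open>P\<close>, where \<open>P\<close> need not commute with
  \<open>X\<close>.\<close>

lemma Re_hs_inner_eigenbasis:
  assumes "hadj P = P" "eigenbasis ((*v) X) B"
  shows "Re (hs_inner P X) = (\<Sum>b\<in>B. (b \<bullet> (X *v b)) * (b \<bullet> (P *v b))) / 2"
proof -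
  have "b \<bullet> (P *v (X *v b)) = (b \<bullet> (X *v b)) * (b \<bullet> (P *v b))" if "b \<in> B" for b
  proof -
    have "X *v b = (b \<bullet> (X *v b)) *\<^sub>R b"
      using that assms(2) by (simp add: eigenbasis_def)
    then have "P *v (X *v b) = (b \<bullet> (X *v b)) *\<^sub>R (P *v b)"
      by (metis linear_cmul linear_matrix_vector_complex)
    then show ?thesis by simp
  qed
  then show ?thesis
    using assms Re_trace[of B "P ** X"]
    by (simp add: hs_inner_def eigenbasis_def matrix_vector_mul_assoc[symmetric])
qed

lemma hermitian_eigenbasis:
  assumes "hadj A = A"
  obtains B where "eigenbasis ((*v) A) B"
  using assms selfadjoint_eigenbasis hermitian_iff_selfadjoint by blast

lemma hs_inner_psd_nonneg:
  assumes "psd P" "psd X"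
  shows "0 \<le> Re (hs_inner P X)"
proof -
  obtain B where B: "eigenbasis ((*v) X) B"
    using hermitian_eigenbasis assms(2) psd_def by blast
  have "0 \<le> (\<Sum>b\<in>B. (b \<bullet> (X *v b)) * (b \<bullet> (P *v b)))"
    using assms by (intro sum_nonneg mult_nonneg_nonneg) (auto simp: psd_iff)
  then show ?thesis
    using assms(1) Re_hs_inner_eigenbasis[OF _ B, of P] by (simp add: psd_def)
qed

lemma measurement_op_bounds:
  assumes "P \<in> measurement_ops" "psd X"
  shows "0 \<le> Re (hs_inner P X)" "Re (hs_inner P X) \<le> Re (trace X)"
proof -
  have "psd P" "psd (mat 1 - P)"
    using assms(1) by (auto simp: measurement_ops_def loewner_le_def)
  then show "0 \<le> Re (hs_inner P X)" "Re (hs_inner P X) \<le> Re (trace X)"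
    using hs_inner_psd_nonneg[of P X] hs_inner_psd_nonneg[of "mat 1 - P" X] assms(2)
    by (simp_all add: hs_inner_diff_left hs_inner_mat_1_left)
qed

section \<open>The matrix exponential\<close>

text \<open>Left multiplication by \<open>A\<close> is a bounded linear map. Its bound
  \<open>K\<close> replaces a submultiplicative norm, and the series of \<open>exp K\<close>
  dominates up to a constant.\<close>

lemma mexp_summable: "summable (\<lambda>k. (1 / fact k) *\<^sub>R (((**) (A :: complex^'n^'n) ^^ k) (mat 1)))"
proof -
  have "linear ((**) A :: complex^'n^'n \<Rightarrow> complex^'n^'n)"
    by (rule linearI) (simp_all add: matrix_add_ldistrib matrix_scalar_ac scalar_matrix_assoc)
  then have "bounded_linear ((**) A :: complex^'n^'n \<Rightarrow> complex^'n^'n)"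
    by (rule linear_conv_bounded_linear[THEN iffD1])
  then obtain K where K: "K > 0" "\<And>X :: complex^'n^'n. norm (A ** X) \<le> norm X * K"
    using bounded_linear.pos_bounded by blast
  have *: "norm (((**) A ^^ k) (mat 1)) \<le> norm (mat 1 :: complex^'n^'n) * K ^ k" for k
  proof (induction k)
    case (Suc k)
    have "norm (((**) A ^^ Suc k) (mat 1)) \<le> norm (((**) A ^^ k) (mat 1)) * K"
      using K(2) by simp
    also have "\<dots> \<le> norm (mat 1 :: complex^'n^'n) * K ^ k * K"
      using Suc K(1) by (intro mult_right_mono) auto
    finally show ?case by (simp add: mult_ac)
  qed simp
  show ?thesis
  proof (rule summable_comparison_test')
    show "summable (\<lambda>k. norm (mat 1 :: complex^'n^'n) * (inverse (fact k) * K ^ k))"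
      by (intro summable_mult summable_exp)
    show "norm ((1 / fact k) *\<^sub>R (((**) A ^^ k) (mat 1))) \<le> norm (mat 1 :: complex^'n^'n) * (inverse (fact k) * K ^ k)"
      if "k \<ge> 0" for k
      using mult_left_mono[OF *[of k], of "inverse (fact k)"] by (simp add: divide_inverse mult_ac)
  qed
qed

text \<open>Evaluation at \<open>v\<close> is bounded and linear in the matrix, so it passes through
  the series. The later facts about \<open>mexp\<close> rest on this one.\<close>

lemma mexp_eigenvector:
  fixes A :: "complex^'n^'n"
  assumes v: "A *v v = a *\<^sub>R v"
  shows "mexp A *v v = exp a *\<^sub>R v"
proof -
  have it: "(((**) A ^^ k) (mat 1)) *v v = (a ^ k) *\<^sub>R v" for k
  proof (induction k)
    case (Suc k)
    have "(((**) A ^^ Suc k) (mat 1)) *v v = A *v ((((**) A ^^ k) (mat 1)) *v v)"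
      by (simp add: matrix_vector_mul_assoc)
    then show ?case
      using Suc v linear_cmul[OF linear_matrix_vector_complex, of A "a ^ k" v] by (simp add: mult.commute)
  qed simp
  have lin: "linear (\<lambda>X :: complex^'n^'n. X *v v)"
    by (rule linearI)
      (simp_all add: matrix_vector_mult_def vec_eq_iff scaleR_sum_right distrib_right sum.distrib)
  have "mexp A *v v = (\<Sum>k. ((1 / fact k) *\<^sub>R (((**) A ^^ k) (mat 1))) *v v)"
    unfolding mexp_def
    by (rule bounded_linear.suminf[OF linear_conv_bounded_linear[THEN iffD1, OF lin] mexp_summable])
  also have "\<dots> = (\<Sum>k. (a ^ k /\<^sub>R fact k) *\<^sub>R v)"
    by (simp add: linear_cmul[OF lin] it divide_inverse)
  also have "\<dots> = exp a *\<^sub>R v"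
    by (rule sums_unique[symmetric])
      (rule bounded_linear.sums[OF bounded_linear_scaleR_left exp_converges])
  finally show ?thesis .
qed

lemma mexp_zero: "mexp 0 = (mat 1 :: complex^'n^'n)"
proof -
  have "mexp 0 *v v = v" for v :: "complex^'n"
    using mexp_eigenvector[of 0 v 0] by simp
  then show ?thesis by (simp add: matrix_eq)
qed

lemma mexp_eigenbasis:
  assumes "eigenbasis ((*v) A) B"
  shows "eigenbasis ((*v) (mexp A)) B" "\<And>b. b \<in> B \<Longrightarrow> b \<bullet> (mexp A *v b) = exp (b \<bullet> (A *v b))"
    "selfadjoint ((*v) (mexp A))"
proof -
  have "mexp A *v b = exp (b \<bullet> (A *v b)) *\<^sub>R b" if "b \<in> B" for b
    using assms that by (intro mexp_eigenvector) (simp add: eigenbasis_def)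
  note diagonal_selfadjoint[OF linear_matrix_vector_complex _ this, of B]
  then show "eigenbasis ((*v) (mexp A)) B" "\<And>b. b \<in> B \<Longrightarrow> b \<bullet> (mexp A *v b) = exp (b \<bullet> (A *v b))"
    "selfadjoint ((*v) (mexp A))"
    using assms by (auto simp: eigenbasis_def)
qed

lemma psd_mexp:
  assumes "hadj A = A"
  shows "psd (mexp A)"
proof -
  obtain B where B: "eigenbasis ((*v) A) B"
    using hermitian_eigenbasis[OF assms] .
  have "0 \<le> v \<bullet> (mexp A *v v)" for v
    unfolding eigenbasis_quadratic_form[OF mexp_eigenbasis(3)[OF B] mexp_eigenbasis(1)[OF B], of v]
    by (intro sum_nonneg) (simp add: mexp_eigenbasis(2)[OF B])
  then show ?thesis
    using mexp_eigenbasis(3)[OF B] by (simp add: psd_iff)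
qed

lemma trace_mexp:
  assumes "eigenbasis ((*v) A) B"
  shows "Re (trace (mexp A)) = (\<Sum>b\<in>B. exp (b \<bullet> (A *v b))) / 2"
  using assms mexp_eigenbasis(2)[OF assms] by (subst Re_trace[of B]) (auto simp: eigenbasis_def)

lemma trace_hermitian_real: "hadj A = A \<Longrightarrow> trace A = of_real (Re (trace A))"
  using hs_inner_real[of "mat 1" A] by (simp add: hadj_mat_1 hs_inner_mat_1_left)

lemma trace_mexp_pos:
  assumes "hadj A = A"
  shows "0 < Re (trace (mexp A))"
proof -
  obtain B where B: "eigenbasis ((*v) A) B"
    using hermitian_eigenbasis[OF assms] .
  then have "finite B" "span B = UNIV"
    by (auto simp: eigenbasis_def orthonormal_basis_def)
  moreover have "B \<noteq> {}"
  proof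
    assume "B = {}"
    then have "(UNIV :: (complex^'a) set) = {0}" using \<open>span B = UNIV\<close> by simp
    then have "(1 :: complex^'a) = 0" by blast
    then show False by simp
  qed
  ultimately show ?thesis
    by (simp add: trace_mexp[OF B] sum_pos)
qed

lemma mexp_step:
  assumes A: "hadj A = A" and M: "psd M" "psd (mat 1 - M)" and \<epsilon>: "0 \<le> \<epsilon>"
  shows "Re (trace (mexp (A - \<epsilon> *\<^sub>R M)))
    \<le> (1 + \<epsilon>\<^sup>2) * Re (trace (mexp A)) - \<epsilon> * Re (hs_inner M (mexp A))"
proof -
  have hM: "hadj M = M" using M(1) by (simp add: psd_def)
  have hC: "hadj (A - \<epsilon> *\<^sub>R M) = A - \<epsilon> *\<^sub>R M"
    by (simp add: hadj_diff hadj_scaleR A hM)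
  obtain B where B: "eigenbasis ((*v) A) B"
    using hermitian_eigenbasis[OF A] .
  obtain D where D: "eigenbasis ((*v) (A - \<epsilon> *\<^sub>R M)) D"
    using hermitian_eigenbasis[OF hC] .
  have "(\<Sum>d\<in>D. exp (d \<bullet> ((A - \<epsilon> *\<^sub>R M) *v d)))
    \<le> (1 + \<epsilon>\<^sup>2) * (\<Sum>b\<in>B. exp (b \<bullet> (A *v b))) - \<epsilon> * (\<Sum>b\<in>B. exp (b \<bullet> (A *v b)) * (b \<bullet> (M *v b)))"
  proof (rule trace_exp_step[OF _ B _ D _ _ _ _ \<epsilon>])
    show "0 \<le> x \<bullet> (M *v x)" for x using M(1) by (simp add: psd_iff)
    show "x \<bullet> (M *v x) \<le> x \<bullet> x" for x
      using M(2) by (simp add: psd_iff matrix_vector_mult_diff_rdistrib inner_diff_right)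
    show "(A - \<epsilon> *\<^sub>R M) *v x = A *v x - \<epsilon> *\<^sub>R (M *v x)" for x
      by (simp add: matrix_vector_mult_diff_rdistrib)
        (simp add: matrix_vector_mult_def vec_eq_iff scaleR_sum_right)
  qed (use A hM hC hermitian_iff_selfadjoint in auto)
  moreover have "Re (hs_inner M (mexp A)) = (\<Sum>b\<in>B. exp (b \<bullet> (A *v b)) * (b \<bullet> (M *v b))) / 2"
    using Re_hs_inner_eigenbasis[OF hM mexp_eigenbasis(1)[OF B]] mexp_eigenbasis(2)[OF B] by simp
  ultimately show ?thesis
    by (simp add: trace_mexp[OF B] trace_mexp[OF D] field_simps)
qed

section \<open>Rank-one operators and expectations of Hermitian operators\<close>

definition rank_one :: "complex^'n \<Rightarrow> complex^'n^'n" where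
  "rank_one v = (\<chi> i j. v $ i * cnj (v $ j))"

lemma rank_one_quadratic_form: "cdot x (rank_one v *v x) = cdot v x * cnj (cdot v x)"
proof -
  have "rank_one v *v x = cdot v x *s v"
    by (simp add: rank_one_def matrix_vector_mult_def vec_eq_iff cdot_def sum_distrib_left
        sum_distrib_right mult_ac)
  moreover have "cdot x (c *s v) = c * cnj (cdot v x)" for c
    by (simp add: cdot_def sum_distrib_left mult_ac)
  ultimately show ?thesis by simp
qed

lemma hadj_rank_one: "hadj (rank_one v) = rank_one v"
  by (simp add: rank_one_def hadj_def vec_eq_iff)

lemma psd_rank_one: "psd (rank_one v)"
  by (simp add: psd_def hadj_rank_one rank_one_quadratic_form)

lemma trace_rank_one: "trace (rank_one v) = of_real (v \<bullet> v)"
  by (simp add: rank_one_def trace_def inner_vec_def complex_mult_cnj inner_complex_def power2_eq_square)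

text \<open>Pairing with \<open>rank_one v\<close> reads off the quadratic form at \<open>v\<close>,
  so bounds on pairings become operator inequalities.\<close>

lemma hs_inner_rank_one: "hs_inner A (rank_one v) = cnj (cdot v (A *v v))"
  unfolding hs_inner_eq_sum rank_one_def cdot_def matrix_vector_mult_def
  by (simp add: sum_distrib_left mult_ac) (rule sum.swap)

text \<open>A unit vector spans a real plane with orthonormal basis \<open>v\<close>, \<open>\<i> v\<close>.\<close>

lemma density_diagonal_le_1:
  fixes \<rho> :: "complex^'n^'n"
  assumes \<rho>: "\<rho> \<in> density_ops" and v: "norm v = 1"
  shows "v \<bullet> (\<rho> *v v) \<le> 1"
proof -
  \<comment> \<open>Positivity here is Bessel's inequality for the real orthonormal pair
    \<open>v\<close>, \<open>\<i> v\<close>; pairing the operator with \<open>\<rho>\<close> then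
    gives the claim.\<close>
  have "psd (mat 1 - rank_one v)"
    unfolding psd_def
  proof (intro conjI allI)
    show "hadj (mat 1 - rank_one v) = mat 1 - rank_one v"
      by (simp add: hadj_diff hadj_mat_1 hadj_rank_one)
    fix x
    define w where "w = \<i> *s v"
    have vv: "v \<bullet> v = 1" and ww: "w \<bullet> w = 1" and vw: "v \<bullet> w = 0"
      using v by (simp_all add: w_def norm_eq_1) (simp_all add: inner_vec_def inner_complex_def add.commute)
    have "x \<bullet> (rank_one v *v x) = Re (cdot v x * cnj (cdot v x))"
      by (simp only: inner_eq_Re_cdot rank_one_quadratic_form)
    also have "\<dots> = (v \<bullet> x)\<^sup>2 + (w \<bullet> x)\<^sup>2"
      by (simp add: cdot_eq_inner[of v x] w_def power2_eq_square)
    finally have quad: "x \<bullet> (rank_one v *v x) = (v \<bullet> x)\<^sup>2 + (w \<bullet> x)\<^sup>2" .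
    have "0 \<le> (x - (v \<bullet> x) *\<^sub>R v - (w \<bullet> x) *\<^sub>R w) \<bullet> (x - (v \<bullet> x) *\<^sub>R v - (w \<bullet> x) *\<^sub>R w)"
      by simp
    also have "\<dots> = x \<bullet> x - (v \<bullet> x)\<^sup>2 - (w \<bullet> x)\<^sup>2"
      using vv ww vw
      by (simp add: inner_diff_left inner_diff_right inner_commute
          power2_eq_square algebra_simps)
    finally show "0 \<le> Re (cdot x ((mat 1 - rank_one v) *v x))"
      by (simp add: inner_eq_Re_cdot[symmetric] matrix_vector_mult_diff_rdistrib inner_diff_right quad)
  qed
  from hs_inner_psd_nonneg[OF _ this, of \<rho>] show ?thesis
    using \<rho> by (simp add: density_ops_def hs_inner_diff_right hs_inner_mat_1_right psd_def
        hs_inner_rank_one inner_eq_Re_cdot[of v "\<rho> *v v"])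
qed

text \<open>Jensen's inequality for the eigenvalues of \<open>A\<close> distributed according to the
  diagonal of \<open>\<rho>\<close>, in tangent form at the mean \<open>c\<close>: the deviations
  from \<open>c\<close> average to zero.\<close>

lemma exp_hs_inner_le_trace_mexp:
  assumes A: "hadj A = A" and \<rho>: "\<rho> \<in> density_ops"
  shows "exp (Re (hs_inner A \<rho>)) \<le> Re (trace (mexp A))"
proof -
  have h\<rho>: "hadj \<rho> = \<rho>" and tr: "Re (trace \<rho>) = 1" and pos: "\<And>v. 0 \<le> v \<bullet> (\<rho> *v v)"
    using \<rho> by (auto simp: density_ops_def psd_iff hermitian_iff_selfadjoint)
  obtain B where B: "eigenbasis ((*v) A) B"
    using hermitian_eigenbasis[OF A] .
  then have oB: "orthonormal_basis B" by (simp add: eigenbasis_def)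
  let ?a = "\<lambda>b. b \<bullet> (A *v b)" and ?p = "\<lambda>b. b \<bullet> (\<rho> *v b)"
  define c where "c = Re (hs_inner A \<rho>)"
  have "hs_inner A \<rho> = cnj (hs_inner \<rho> A)"
    unfolding hs_inner_eq_sum by (simp add: mult.commute)
  then have c: "2 * c = (\<Sum>b\<in>B. ?a b * ?p b)"
    using Re_hs_inner_eigenbasis[OF h\<rho> B] by (simp add: c_def)
  have p: "(\<Sum>b\<in>B. ?p b) = 2"
    using Re_trace[OF oB, of \<rho>] tr by simp
  have "2 * exp c = (\<Sum>b\<in>B. ?p b * (exp c * (1 + (?a b - c))))"
  proof -
    have "(\<Sum>b\<in>B. ?p b * (exp c * (1 + (?a b - c))))
        = exp c * ((1 - c) * (\<Sum>b\<in>B. ?p b) + (\<Sum>b\<in>B. ?a b * ?p b))"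
      by (simp add: sum_distrib_left sum.distrib[symmetric] algebra_simps)
    then show ?thesis
      by (simp add: p c[symmetric] algebra_simps)
  qed
  also have "\<dots> \<le> (\<Sum>b\<in>B. exp (?a b))"
  proof (rule sum_mono)
    fix b assume "b \<in> B"
    \<comment> \<open>The weights sum to 2 over the real basis. Bounding each by 1 avoids losing a
      factor 2 in the trace, which would turn \<open>ln N\<close> into
      \<open>ln (2 N)\<close>.\<close>
    then have "?p b \<le> 1"
      using oB by (intro density_diagonal_le_1[OF \<rho>]) (simp add: orthonormal_basis_def)
    have "exp c * (1 + (?a b - c)) \<le> exp c * exp (?a b - c)"
      by (intro mult_left_mono exp_ge_add_one_self) auto
    then have "exp c * (1 + (?a b - c)) \<le> exp (?a b)"
      by (simp add: exp_add[symmetric])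
    then have "?p b * (exp c * (1 + (?a b - c))) \<le> ?p b * exp (?a b)"
      by (intro mult_left_mono pos)
    also have "\<dots> \<le> exp (?a b)"
      using \<open>?p b \<le> 1\<close> by simp
    finally show "?p b * (exp c * (1 + (?a b - c))) \<le> exp (?a b)" .
  qed
  finally show ?thesis
    by (simp add: trace_mexp[OF B] c_def)
qed

section \<open>Projection onto the positive eigenspaces\<close>

text \<open>Existence comes from the real orthogonal decomposition; closure of \<open>S\<close>
  under multiplication by \<open>\<i>\<close> upgrades real orthogonality to complex. Uniqueness
  then yields complex linearity, hence a matrix, and identifies it with the description in
  \<open>orth_proj\<close>.\<close>

lemma orth_proj_works:
  fixes S :: "(complex^'n) set"
  assumes S: "vec.subspace S"
  shows "orth_proj S *v v \<in> S" "u \<in> S \<Longrightarrow> cdot u (v - orth_proj S *v v) = 0"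
    "x \<in> S \<Longrightarrow> (\<And>u. u \<in> S \<Longrightarrow> cdot u (v - x) = 0) \<Longrightarrow> orth_proj S *v v = x"
proof -
  have scaleR: "r *\<^sub>R x = of_real r *s x" for r and x :: "complex^'n"
    by (simp add: vec_eq_iff scaleR_conv_of_real[where 'a=complex])
  have "subspace S"
    using S by (simp add: subspace_def vec.subspace_def scaleR)
  then have span: "span S = S" by (rule span_eq_iff[THEN iffD2])
  have "\<exists>x\<in>S. \<forall>u\<in>S. cdot u (v - x) = 0" for v
  proof -
    obtain y z where yz: "y \<in> span S" "\<And>w. w \<in> span S \<Longrightarrow> orthogonal z w" "v = y + z"
      using orthogonal_subspace_decomp_exists[of S v] by blast
    have "cdot u (v - y) = 0" if "u \<in> S" for u
    proof -
      have "\<i> *s u \<in> S" using S that by (simp add: vec.subspace_scale)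
      then show ?thesis
        using yz(2)[of u] yz(2)[of "\<i> *s u"] yz(3) that
        by (simp add: span cdot_eq_inner orthogonal_def inner_commute complex_eq_iff)
    qed
    then show ?thesis using yz(1) by (auto simp: span)
  qed
  then obtain p where p: "\<And>v. p v \<in> S" "\<And>v u. u \<in> S \<Longrightarrow> cdot u (v - p v) = 0"
    by metis
  have uniq: "p v = x" if "x \<in> S" "\<And>u. u \<in> S \<Longrightarrow> cdot u (v - x) = 0" for v x
  proof -
    have "p v - x \<in> S" using p(1) that(1) S by (simp add: vec.subspace_diff)
    from p(2)[OF this, of v] that(2)[OF this] have "(p v - x) \<bullet> (v - p v) = 0" "(p v - x) \<bullet> (v - x) = 0"
      by (simp_all add: inner_eq_Re_cdot)
    then have "(p v - x) \<bullet> (p v - x) = 0"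
      by (simp add: inner_diff_right)
    then show ?thesis by simp
  qed
  have "Vector_Spaces.linear (*s) (*s) p"
    unfolding Vector_Spaces.linear_iff
  proof (intro conjI allI vec.vector_space_axioms)
    fix x y :: "complex^'n" and c :: complex
    have "cdot u (x + y - (p x + p y)) = cdot u (x - p x) + cdot u (y - p y)" for u
      by (simp add: cdot_def algebra_simps sum.distrib sum_subtractf)
    then show "p (x + y) = p x + p y"
      using p S by (intro uniq) (simp_all add: vec.subspace_add)
    have "cdot u (c *s x - c *s p x) = c * cdot u (x - p x)" for u
      by (simp add: cdot_def algebra_simps sum_distrib_left sum_subtractf)
    then show "p (c *s x) = c *s p x"
      using p S by (intro uniq) (simp_all add: vec.subspace_scale)
  qed
  then have P: "matrix p *v v = p v" for v by (rule matrix_works)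
  have "orth_proj S = matrix p"
    unfolding orth_proj_def
  proof (rule the_equality)
    show "\<forall>v. matrix p *v v \<in> S \<and> (\<forall>u\<in>S. cdot u (v - matrix p *v v) = 0)"
      using p by (simp add: P)
  next
    fix Q assume "\<forall>v. Q *v v \<in> S \<and> (\<forall>u\<in>S. cdot u (v - Q *v v) = 0)"
    then have "p v = Q *v v" for v by (intro uniq) auto
    then show "Q = matrix p" by (simp add: matrix_eq P)
  qed
  then show "orth_proj S *v v \<in> S" "u \<in> S \<Longrightarrow> cdot u (v - orth_proj S *v v) = 0"
    "x \<in> S \<Longrightarrow> (\<And>u. u \<in> S \<Longrightarrow> cdot u (v - x) = 0) \<Longrightarrow> orth_proj S *v v = x"
    using p uniq by (simp_all add: P)
qed

text \<open>For positive \<open>h\<close> the vector lies in the subspace. Otherwise it is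
  orthogonal to every eigenvector with positive eigenvalue, and the vectors orthogonal to
  \<open>b\<close> form a subspace, so this extends to the span.\<close>

lemma orth_proj_positive_eigenspace:
  assumes H: "hadj H = H" and b: "H *v b = h *\<^sub>R b"
  shows "orth_proj (positive_eigenspace H) *v b = (if 0 < h then 1 else 0) *\<^sub>R b"
proof (cases "0 < h")
  case True
  have "h *\<^sub>R b = complex_of_real h *s b"
    by (simp add: vec_eq_iff scaleR_conv_of_real[where 'a=complex])
  then have "b \<in> positive_eigenspace H"
    unfolding positive_eigenspace_def using True b by (intro vec.span_base) auto
  then show ?thesis
    using True unfolding positive_eigenspace_def
    by (simp add: orth_proj_works(3) cdot_def)
next
  case False
  have "{v. \<exists>c::real. 0 < c \<and> H *v v = complex_of_real c *s v} \<subseteq> {u. cdot u b = 0}"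
  proof clarify
    fix v c assume c: "0 < c" "H *v v = complex_of_real c *s v"
    have "cdot v (H *v b) = of_real h * cdot v b"
      by (simp add: b cdot_def sum_distrib_left scaleR_conv_of_real[where 'a=complex] mult_ac)
    moreover have "cdot (H *v v) b = of_real c * cdot v b"
      by (simp add: c(2) cdot_def sum_distrib_left mult_ac)
    ultimately have "of_real h * cdot v b = of_real c * cdot v b"
      using cdot_hadj[of v H b] H by metis
    moreover have "h \<noteq> c" using c(1) False by simp
    ultimately show "cdot v b = 0" by simp
  qed
  moreover have "vec.subspace {u. cdot u b = 0}"
    unfolding vec.subspace_def
    by (simp add: cdot_def algebra_simps sum.distrib sum_distrib_left[symmetric])
  ultimately have "positive_eigenspace H \<subseteq> {u. cdot u b = 0}"
    unfolding positive_eigenspace_def by (rule vec.span_minimal)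
  then show ?thesis
    using False unfolding positive_eigenspace_def
    by (auto intro!: orth_proj_works(3) simp: vec.span_zero)
qed

text \<open>In an eigenbasis of \<open>H\<close> the pairing is half the sum of eigenvalues times
  weights in \<open>[0, 1]\<close>. It is largest when the weight is 1 on positive eigenvalues and 0
  elsewhere, which describes the projection.\<close>

lemma
  assumes H: "hadj H = H"
  shows positive_projection_measurement: "orth_proj (positive_eigenspace H) \<in> measurement_ops"
    and positive_projection_optimal: "Q \<in> measurement_ops \<Longrightarrow>
      Re (hs_inner Q H) \<le> Re (hs_inner (orth_proj (positive_eigenspace H)) H)"
proof -
  let ?P = "orth_proj (positive_eigenspace H)"
  obtain B where B: "eigenbasis ((*v) H) B"
    using hermitian_eigenbasis[OF H] .
  then have oB: "orthonormal_basis B" by (simp add: eigenbasis_def)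
  define e where "e b = (if 0 < b \<bullet> (H *v b) then 1 else 0 :: real)" for b
  have "?P *v b = e b *\<^sub>R b" if "b \<in> B" for b
    unfolding e_def using B that by (intro orth_proj_positive_eigenspace[OF H]) (simp add: eigenbasis_def)
  then have P: "selfadjoint ((*v) ?P)" "eigenbasis ((*v) ?P) B" "\<And>b. b \<in> B \<Longrightarrow> b \<bullet> (?P *v b) = e b"
    using diagonal_selfadjoint[OF linear_matrix_vector_complex[of ?P] oB, of e] by blast+
  have hP: "hadj ?P = ?P" using P(1) by (simp add: hermitian_iff_selfadjoint)
  have quad: "x \<bullet> (?P *v x) = (\<Sum>b\<in>B. e b * (x \<bullet> b)\<^sup>2)" for x
  proof -
    have "x \<bullet> (?P *v x) = (\<Sum>b\<in>B. (b \<bullet> (?P *v b)) * (x \<bullet> b)\<^sup>2)"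
      by (rule eigenbasis_quadratic_form[OF P(1,2)])
    also have "\<dots> = (\<Sum>b\<in>B. e b * (x \<bullet> b)\<^sup>2)"
      by (intro sum.cong) (simp_all add: P(3))
    finally show ?thesis .
  qed
  have "psd ?P"
    using P(1) by (simp add: psd_iff quad e_def sum_nonneg)
  moreover have "psd (mat 1 - ?P)"
  proof -
    have "x \<bullet> (?P *v x) \<le> x \<bullet> x" for x
      unfolding quad orthonormal_basis_inner[OF oB, of x x]
      by (intro sum_mono) (simp add: e_def power2_eq_square)
    then show ?thesis
      by (simp add: psd_def hadj_diff hadj_mat_1 hP inner_eq_Re_cdot[symmetric]
          matrix_vector_mult_diff_rdistrib inner_diff_right)
  qed
  ultimately show "?P \<in> measurement_ops"
    by (simp add: measurement_ops_def loewner_le_def)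
  assume "Q \<in> measurement_ops"
  then have Q: "psd Q" "psd (mat 1 - Q)"
    by (auto simp: measurement_ops_def loewner_le_def)
  have "(\<Sum>b\<in>B. (b \<bullet> (H *v b)) * (b \<bullet> (Q *v b))) \<le> (\<Sum>b\<in>B. (b \<bullet> (H *v b)) * (b \<bullet> (?P *v b)))"
  proof (rule sum_mono)
    fix b assume b: "b \<in> B"
    have "b \<bullet> b = 1" using b oB by (auto simp: orthonormal_basis_def norm_eq_1)
    then have "0 \<le> b \<bullet> (Q *v b)" "b \<bullet> (Q *v b) \<le> 1"
      using Q by (auto simp: psd_iff matrix_vector_mult_diff_rdistrib inner_diff_right dest: spec[of _ b])
    then show "(b \<bullet> (H *v b)) * (b \<bullet> (Q *v b)) \<le> (b \<bullet> (H *v b)) * (b \<bullet> (?P *v b))"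
      by (simp add: P(3)[OF b] e_def mult_left_le mult_nonpos_nonneg)
  qed
  then show "Re (hs_inner Q H) \<le> Re (hs_inner ?P H)"
    using Q(1) by (simp add: Re_hs_inner_eigenbasis[OF _ B] hP psd_def)
qed

section \<open>Adjoint super-operators\<close>

lemma mult_nested_if: "c * (if P then if Q then 1 else 0 else 0) = (if P then if Q then c else 0 else 0)"
  for c :: complex
  by simp

lemma hs_inner_nondegenerate:
  assumes "\<And>X. hs_inner A X = hs_inner B X"
  shows "A = B"
proof -
  have "cnj (A $ k $ l) = cnj (B $ k $ l)" for k l
    using assms[of "\<chi> i j. if i = k then if j = l then 1 else 0 else 0"]
    unfolding hs_inner_eq_sum by (simp add: mult_nested_if)
  then show ?thesis by (simp add: vec_eq_iff)
qed

lemma superop_adjoint_works: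
  fixes \<Phi> :: "complex^'n^'n \<Rightarrow> complex^'m^'m"
  assumes "superop_linear \<Phi>"
  shows "hs_inner B (\<Phi> A) = hs_inner (superop_adjoint \<Phi> B) A"
proof -
  have add: "\<Phi> (A + B) = \<Phi> A + \<Phi> B" and scale: "\<Phi> (cscale c A) = cscale c (\<Phi> A)" for A B c
    using assms by (auto simp: superop_linear_def)
  have zero: "\<Phi> 0 = 0" using add[of 0 0] by simp
  have sum: "\<Phi> (sum f I) = (\<Sum>i\<in>I. \<Phi> (f i))" for f :: "'b \<Rightarrow> complex^'n^'n" and I
    by (induction I rule: infinite_finite_induct) (simp_all add: add zero)
  define E where "E i j = ((\<chi> k l. if l = j then if k = i then 1 else 0 else 0) :: complex^'n^'n)" for i j
  \<comment> \<open>Testing the adjoint identity on matrix units forces these entries; the conjugate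
    appears because \<open>hs_inner\<close> is conjugate-linear on the left.\<close>
  define \<Psi> where "\<Psi> B = (\<chi> i j. cnj (hs_inner B (\<Phi> (E i j))))" for B
  have expand: "A = (\<Sum>i\<in>UNIV. \<Sum>j\<in>UNIV. cscale (A $ i $ j) (E i j))" for A :: "complex^'n^'n"
    by (simp add: vec_eq_iff cscale_def E_def mult_nested_if)
  have \<Psi>: "hs_inner B (\<Phi> A) = hs_inner (\<Psi> B) A" for A B
  proof -
    have "hs_inner B (\<Phi> A) = hs_inner B (\<Phi> (\<Sum>i\<in>UNIV. \<Sum>j\<in>UNIV. cscale (A $ i $ j) (E i j)))"
      by (simp only: expand[symmetric])
    also have "\<dots> = (\<Sum>i\<in>UNIV. \<Sum>j\<in>UNIV. A $ i $ j * hs_inner B (\<Phi> (E i j)))"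
      by (simp add: sum scale hs_inner_sum_right hs_inner_cscale_right)
    also have "\<dots> = hs_inner (\<Psi> B) A"
      unfolding hs_inner_eq_sum[of "\<Psi> B"] by (subst sum.swap) (simp add: \<Psi>_def mult.commute)
    finally show ?thesis .
  qed
  have "superop_adjoint \<Phi> = \<Psi>"
    unfolding superop_adjoint_def
  proof (rule the_equality)
    fix \<Psi>' assume *: "\<forall>A B. hs_inner B (\<Phi> A) = hs_inner (\<Psi>' B) A"
    show "\<Psi>' = \<Psi>"
    proof
      fix B
      show "\<Psi>' B = \<Psi> B"
        by (rule hs_inner_nondegenerate) (metis * \<Psi>)
    qed
  qed (simp add: \<Psi>)
  then show ?thesis by (simp add: \<Psi>)
qed

lemma superop_adjoint_hermitian:
  assumes "superop_linear \<Phi>" and herm: "\<And>X. \<Phi> (hadj X) = hadj (\<Phi> X)" and P: "hadj P = P"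
  shows "hadj (superop_adjoint \<Phi> P) = superop_adjoint \<Phi> P"
proof (rule hs_inner_nondegenerate)
  fix X
  have "hs_inner (hadj (superop_adjoint \<Phi> P)) X = cnj (hs_inner (superop_adjoint \<Phi> P) (hadj X))"
    using hs_inner_hadj[of "superop_adjoint \<Phi> P" "hadj X"] by (simp add: hadj_hadj)
  also have "\<dots> = cnj (hs_inner P (hadj (\<Phi> X)))"
    by (simp add: superop_adjoint_works[OF assms(1), symmetric] herm)
  also have "\<dots> = hs_inner P (\<Phi> X)"
    using hs_inner_hadj[of P "\<Phi> X"] P by simp
  finally show "hs_inner (hadj (superop_adjoint \<Phi> P)) X = hs_inner (superop_adjoint \<Phi> P) X"
    by (simp add: superop_adjoint_works[OF assms(1)])
qed

section \<open>The super-operator of two channels\<close>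

lemma sum_UNIV_pair: "sum g UNIV = (\<Sum>a\<in>UNIV. \<Sum>b\<in>UNIV. g (a, b))"
  by (simp add: sum.cartesian_product)

lemma psd_ptrace_fst:
  fixes X :: "complex^('a::finite \<times> 'b::finite)^('a \<times> 'b)"
  assumes X: "psd X"
  shows "psd (ptrace_fst X)"
proof -
  have "0 \<le> Re (cdot v (ptrace_fst X *v v))" for v
  proof -
    \<comment> \<open>\<open>w k\<close> is the product vector of the k-th basis vector with
      \<open>v\<close>; the quadratic form of the partial trace at \<open>v\<close> is the sum of
      those of \<open>X\<close> at the \<open>w k\<close>.\<close>
    define w :: "'a \<Rightarrow> complex^('a \<times> 'b)" where "w k = (\<chi> p. if fst p = k then v $ snd p else 0)" for k
    have w: "(\<Sum>p\<in>UNIV. c p * w k $ p) = (\<Sum>j\<in>UNIV. c (k, j) * v $ j)"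
      for c k
      unfolding sum_UNIV_pair w_def
      by (subst sum.swap, simp add: if_distrib cong: if_cong)
    have w': "(\<Sum>p\<in>UNIV. cnj (w k $ p) * c p) = (\<Sum>j\<in>UNIV. cnj (v $ j) * c (k, j))" for c k
      using arg_cong[OF w[of "\<lambda>p. cnj (c p)" k], of cnj] by (simp add: mult.commute)
    have "cdot v (ptrace_fst X *v v) = (\<Sum>i\<in>UNIV. \<Sum>j\<in>UNIV. \<Sum>k\<in>UNIV. cnj (v $ i) * (X $ (k, i) $ (k, j) * v $ j))"
      by (simp add: cdot_def matrix_vector_mult_def ptrace_fst_def sum_distrib_left sum_distrib_right)
    also have "\<dots> = (\<Sum>i\<in>UNIV. \<Sum>k\<in>UNIV. \<Sum>j\<in>UNIV. cnj (v $ i) * (X $ (k, i) $ (k, j) * v $ j))"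
      by (intro sum.cong refl sum.swap)
    also have "\<dots> = (\<Sum>k\<in>UNIV. \<Sum>i\<in>UNIV. \<Sum>j\<in>UNIV. cnj (v $ i) * (X $ (k, i) $ (k, j) * v $ j))"
      by (rule sum.swap)
    also have "\<dots> = (\<Sum>k\<in>UNIV. cdot (w k) (X *v w k))"
      by (simp add: cdot_def matrix_vector_mult_def w w') (simp add: sum_distrib_left)
    finally show ?thesis
      using X by (simp add: psd_def sum_nonneg)
  qed
  then show ?thesis
    using X by (simp add: psd_def ptrace_fst_def hadj_def vec_eq_iff)
qed

lemma psd_ptrace_snd:
  fixes X :: "complex^('a::finite \<times> 'b::finite)^('a \<times> 'b)"
  assumes X: "psd X"
  shows "psd (ptrace_snd X)"
proof -
  have "0 \<le> Re (cdot v (ptrace_snd X *v v))" for v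
  proof -
    \<comment> \<open>Now \<open>v\<close> is the first tensor factor and the basis vector the
      second.\<close>
    define w :: "'b \<Rightarrow> complex^('a \<times> 'b)" where "w k = (\<chi> p. if snd p = k then v $ fst p else 0)" for k
    have w: "(\<Sum>p\<in>UNIV. c p * w k $ p) = (\<Sum>j\<in>UNIV. c (j, k) * v $ j)"
      for c k
      unfolding sum_UNIV_pair w_def
      by (simp add: if_distrib cong: if_cong)
    have w': "(\<Sum>p\<in>UNIV. cnj (w k $ p) * c p) = (\<Sum>j\<in>UNIV. cnj (v $ j) * c (j, k))" for c k
      using arg_cong[OF w[of "\<lambda>p. cnj (c p)" k], of cnj] by (simp add: mult.commute)
    have "cdot v (ptrace_snd X *v v) = (\<Sum>i\<in>UNIV. \<Sum>j\<in>UNIV. \<Sum>k\<in>UNIV. cnj (v $ i) * (X $ (i, k) $ (j, k) * v $ j))"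
      by (simp add: cdot_def matrix_vector_mult_def ptrace_snd_def sum_distrib_left sum_distrib_right)
    also have "\<dots> = (\<Sum>i\<in>UNIV. \<Sum>k\<in>UNIV. \<Sum>j\<in>UNIV. cnj (v $ i) * (X $ (i, k) $ (j, k) * v $ j))"
      by (intro sum.cong refl sum.swap)
    also have "\<dots> = (\<Sum>k\<in>UNIV. \<Sum>i\<in>UNIV. \<Sum>j\<in>UNIV. cnj (v $ i) * (X $ (i, k) $ (j, k) * v $ j))"
      by (rule sum.swap)
    also have "\<dots> = (\<Sum>k\<in>UNIV. cdot (w k) (X *v w k))"
      by (simp add: cdot_def matrix_vector_mult_def w w') (simp add: sum_distrib_left)
    finally show ?thesis
      using X by (simp add: psd_def sum_nonneg)
  qed
  then show ?thesis
    using X by (simp add: psd_def ptrace_snd_def hadj_def vec_eq_iff)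
qed

lemma trace_ptrace_fst: "trace (ptrace_fst X) = trace X"
  by (simp add: trace_def ptrace_fst_def sum_UNIV_pair) (rule sum.swap)

lemma trace_ptrace_snd: "trace (ptrace_snd X) = trace X"
  by (simp add: trace_def ptrace_snd_def sum_UNIV_pair)

lemma ptrace_linear:
  "ptrace_fst (A + B) = ptrace_fst A + ptrace_fst B" "ptrace_snd (A + B) = ptrace_snd A + ptrace_snd B"
  "ptrace_fst (cscale c A) = cscale c (ptrace_fst A)" "ptrace_snd (cscale c A) = cscale c (ptrace_snd A)"
  "ptrace_fst (hadj A) = hadj (ptrace_fst A)" "ptrace_snd (hadj A) = hadj (ptrace_snd A)"
  by (simp_all add: ptrace_fst_def ptrace_snd_def cscale_def hadj_def vec_eq_iff sum.distrib sum_distrib_left)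

section \<open>Positivity and norm bounds for \<open>Xi\<close> and its adjoint\<close>

lemma psd_conj:
  assumes "psd X"
  shows "psd (C ** X ** hadj C)"
proof -
  have "cdot v ((C ** X ** hadj C) *v v) = cdot (hadj C *v v) (X *v (hadj C *v v))" for v
    by (simp only: matrix_vector_mul_assoc[symmetric] cdot_hadj[of v C])
  then show ?thesis
    using assms by (simp add: psd_def hadj_mult hadj_hadj matrix_mul_assoc)
qed

lemma trace_conj:
  assumes "isometry C"
  shows "trace (C ** X ** hadj C) = trace X"
  using assms trace_mul_sym[of C "X ** hadj C"] trace_mul_sym[of X "hadj C ** C"]
  by (simp add: isometry_def matrix_mul_assoc[symmetric])

text \<open>Orthogonality of the two kets removes the cross terms, and the minus sign in
  \<open>C1\<close> squares away; what remains is the average of the two Gram matrices.\<close>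

lemma isometry_C:
  fixes A0 A1 :: "complex^'x^('y::finite \<times> 'z::finite)"
  assumes "isometry A0" "isometry A1"
  shows "isometry (C0 A0 A1)" "isometry (C1 A0 A1)"
proof -
  \<comment> \<open>\<open>sum_2\<close> lists the elements of the index type as 1 and 2, and there
    2 equals 0.\<close>
  have two: "sum g (UNIV :: 2 set) = g 0 + g 1" for g :: "2 \<Rightarrow> complex"
  proof -
    have "(2 :: 2) = 0" using exhaust_2[of 0] by auto
    then show ?thesis unfolding sum_2 by (simp only: add.commute)
  qed
  have "(\<Sum>y\<in>UNIV. \<Sum>z\<in>UNIV. cnj (A $ (y, z) $ a) * A $ (y, z) $ b) = (if a = b then 1 else 0)"
    if "isometry A" for A :: "complex^'x^('y \<times> 'z)" and a b
    using that by (simp add: isometry_def hadj_def matrix_matrix_mult_def vec_eq_iff mat_def sum_UNIV_pair)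
  note * = this[OF assms(1)] this[OF assms(2)]
  have C: "(\<Sum>q\<in>UNIV. cnj (C0 A0 A1 $ (y, z, q) $ a) * C0 A0 A1 $ (y, z, q) $ b)
      = (cnj (A0 $ (y, z) $ a) * A0 $ (y, z) $ b + cnj (A1 $ (y, z) $ a) * A1 $ (y, z) $ b) / 2"
    "(\<Sum>q\<in>UNIV. cnj (C1 A0 A1 $ (y, z, q) $ a) * C1 A0 A1 $ (y, z, q) $ b)
      = (cnj (A0 $ (y, z) $ a) * A0 $ (y, z) $ b + cnj (A1 $ (y, z) $ a) * A1 $ (y, z) $ b) / 2" for y z a b
    unfolding two C0_def C1_def tensor_ket_def by (simp_all add: axis_def add_divide_distrib)
      (simp_all add: scaleR_conv_of_real)
  show "isometry (C0 A0 A1)" "isometry (C1 A0 A1)"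
    by (simp_all add: isometry_def hadj_def matrix_matrix_mult_def vec_eq_iff mat_def sum_UNIV_pair C *
        sum.distrib sum_divide_distrib[symmetric])
qed

lemma matrix_add_rdistrib: "(A + B) ** C = A ** C + B ** C"
  by (simp add: matrix_matrix_mult_def vec_eq_iff distrib_right sum.distrib)

lemma cscale_mult: "C ** cscale c X ** D = cscale c (C ** X ** D)"
  by (simp add: matrix_matrix_mult_def cscale_def vec_eq_iff sum_distrib_left sum_distrib_right mult_ac)

lemma superop_linear_Xi: "superop_linear (Xi A0 A1)"
  unfolding superop_linear_def Xi_def Phi_A_def Phi_B_def
  by (auto simp: ptrace_linear matrix_add_ldistrib matrix_add_rdistrib cscale_mult)
    (simp add: cscale_def vec_eq_iff algebra_simps)

lemma Xi_hadj: "Xi A0 A1 (hadj X) = hadj (Xi A0 A1 X)"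
  unfolding Xi_def Phi_A_def Phi_B_def
  by (simp add: hadj_diff ptrace_linear(5,6)[symmetric] hadj_mult hadj_hadj matrix_mul_assoc)

text \<open>\<open>Phi_A\<close> and \<open>Phi_B\<close> composed with the partial traces are
  positive and trace preserving, so the pairing is a difference of two numbers between 0 and the
  trace of \<open>X\<close>.\<close>

lemma Xi_pairing_bounds:
  assumes A: "isometry A0" "isometry A1" and P: "P \<in> measurement_ops" and X: "psd X"
  shows "- Re (trace X) \<le> Re (hs_inner P (Xi A0 A1 X))" "Re (hs_inner P (Xi A0 A1 X)) \<le> Re (trace X)"
proof -
  have a: "psd (Phi_A A0 A1 (ptrace_snd X))" "trace (Phi_A A0 A1 (ptrace_snd X)) = trace X"
    using X A by (simp_all add: Phi_A_def psd_ptrace_fst psd_ptrace_snd psd_conj trace_ptrace_fst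
        trace_ptrace_snd trace_conj isometry_C)
  have b: "psd (Phi_B A0 A1 (ptrace_fst X))" "trace (Phi_B A0 A1 (ptrace_fst X)) = trace X"
    using X A by (simp_all add: Phi_B_def psd_ptrace_fst psd_conj trace_ptrace_fst trace_conj isometry_C)
  show "- Re (trace X) \<le> Re (hs_inner P (Xi A0 A1 X))" "Re (hs_inner P (Xi A0 A1 X)) \<le> Re (trace X)"
    using measurement_op_bounds[OF P a(1)] measurement_op_bounds[OF P b(1)] a(2) b(2)
    by (simp_all add: Xi_def hs_inner_diff_right)
qed

text \<open>Tested on rank-one operators. Halving and shifting by the identity then gives loss
  operators between 0 and \<open>mat 1\<close>, the range in which the regret bound applies.\<close>

lemma Xi_adjoint_bounds:
  assumes A: "isometry A0" "isometry A1" and P: "P \<in> measurement_ops"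
  shows "psd (mat 1 + superop_adjoint (Xi A0 A1) P)" "psd (mat 1 - superop_adjoint (Xi A0 A1) P)"
proof -
  let ?\<Psi> = "superop_adjoint (Xi A0 A1) P"
  have "hadj P = P"
    using P by (simp add: measurement_ops_def loewner_le_def psd_def)
  then have h: "hadj ?\<Psi> = ?\<Psi>"
    by (intro superop_adjoint_hermitian superop_linear_Xi Xi_hadj)
  have "- (v \<bullet> v) \<le> v \<bullet> (?\<Psi> *v v) \<and> v \<bullet> (?\<Psi> *v v) \<le> v \<bullet> v" for v
    using Xi_pairing_bounds[OF A P psd_rank_one[of v]]
    by (simp add: superop_adjoint_works[OF superop_linear_Xi] trace_rank_one hs_inner_rank_one inner_eq_Re_cdot[of v "?\<Psi> *v v"])
  then show "psd (mat 1 + ?\<Psi>)" "psd (mat 1 - ?\<Psi>)"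
    by (simp_all add: psd_def hadj_add hadj_diff hadj_mat_1 h inner_eq_Re_cdot[symmetric] inner_add_right
        inner_diff_right matrix_vector_mult_add_rdistrib matrix_vector_mult_diff_rdistrib)
      (smt (verit))+
qed

section \<open>Regret of matrix multiplicative weights\<close>

lemma psd_scaleR:
  assumes "psd X" "0 \<le> r"
  shows "psd (r *\<^sub>R X)"
proof -
  have "cdot v ((r *\<^sub>R X) *v v) = of_real r * cdot v (X *v v)" for v
    by (simp add: cdot_def matrix_vector_mult_def sum_distrib_left scaleR_conv_of_real[where 'a=complex] mult_ac)
  then show ?thesis
    using assms by (simp add: psd_def hadj_scaleR)
qed

lemma normalized_density:
  assumes W: "psd W" and pos: "0 < Re (trace W)"
  shows "cscale (1 / trace W) W = (1 / Re (trace W)) *\<^sub>R W" "cscale (1 / trace W) W \<in> density_ops"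
proof -
  have tr: "trace W = of_real (Re (trace W))"
    using W by (intro trace_hermitian_real) (simp add: psd_def)
  show eq: "cscale (1 / trace W) W = (1 / Re (trace W)) *\<^sub>R W"
    by (subst tr) (simp add: cscale_def vec_eq_iff scaleR_conv_of_real[where 'a=complex])
  have "trace (cscale c W) = c * trace W" for c
    by (simp add: cscale_def trace_def sum_distrib_left)
  moreover have "psd ((1 / Re (trace W)) *\<^sub>R W)"
    using W pos by (intro psd_scaleR) auto
  ultimately show "cscale (1 / trace W) W \<in> density_ops"
    using pos by (auto simp: density_ops_def eq[symmetric])
qed

lemma matrix_multiplicative_weights_regret:
  fixes M W \<rho> :: "nat \<Rightarrow> complex^'n^'n"
  assumes M: "\<And>t. t \<in> {1..T} \<Longrightarrow> psd (M t)" "\<And>t. t \<in> {1..T} \<Longrightarrow> psd (mat 1 - M t)"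
    and W: "\<And>t. t < T \<Longrightarrow> W (Suc t) = mexp ((- \<epsilon>) *\<^sub>R (\<Sum>\<tau>=1..t. M \<tau>))"
    and \<rho>: "\<And>t. t < T \<Longrightarrow> \<rho> (Suc t) = cscale (1 / trace (W (Suc t))) (W (Suc t))"
    and \<sigma>: "\<sigma> \<in> density_ops" and \<epsilon>: "0 \<le> \<epsilon>"
  shows "\<epsilon> * (\<Sum>t=1..T. Re (hs_inner (M t) (\<rho> t)))
    \<le> \<epsilon> * (\<Sum>t=1..T. Re (hs_inner (M t) \<sigma>)) + ln CARD('n) + T * \<epsilon>\<^sup>2"
proof -
  \<comment> \<open>\<open>A t\<close> is the exponent of the weight used in round
    \<open>Suc t\<close>; the comparison with \<open>\<sigma>\<close> at the end uses
    \<open>A T\<close>, the exponent after the last round.\<close>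
  define A where "A t = (- \<epsilon>) *\<^sub>R (\<Sum>\<tau>=1..t. M \<tau>)" for t
  define Z where "Z t = Re (trace (mexp (A t)))" for t
  define m where "m t = Re (hs_inner (M t) (\<rho> t))" for t
  have herm: "hadj (A t) = A t" if "t \<le> T" for t
    unfolding A_def hadj_scaleR hadj_sum using M(1) that
    by (intro arg_cong[where f = "\<lambda>X. (- \<epsilon>) *\<^sub>R X"] sum.cong) (simp_all add: psd_def)
  have Z_pos: "0 < Z t" if "t \<le> T" for t
    unfolding Z_def by (rule trace_mexp_pos[OF herm[OF that]])
  have "Z t \<le> CARD('n) * exp (\<Sum>\<tau>=1..t. \<epsilon>\<^sup>2 - \<epsilon> * m \<tau>)" if "t \<le> T" for t
    using that
  proof (induction t)
    case 0
    then show ?case by (simp add: Z_def A_def mexp_zero trace_I)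
  next
    case (Suc t)
    then have t: "t \<le> T" "t < T" "Suc t \<in> {1..T}" by auto
    have A: "A (Suc t) = A t - \<epsilon> *\<^sub>R M (Suc t)"
      by (simp add: A_def scaleR_add_right)
    have W': "W (Suc t) = mexp (A t)"
      unfolding A_def by (rule W[OF t(2)])
    have "\<rho> (Suc t) = (1 / Z t) *\<^sub>R mexp (A t)"
      using normalized_density(1)[OF psd_mexp[OF herm[OF t(1)]]] Z_pos[OF t(1)] \<rho>[OF t(2)]
      by (simp add: Z_def W')
    then have "Re (hs_inner (M (Suc t)) (mexp (A t))) = Z t * m (Suc t)"
      using Z_pos[OF t(1)] by (simp add: m_def hs_inner_scaleR_right)
    then have "Z (Suc t) \<le> Z t * (1 + (\<epsilon>\<^sup>2 - \<epsilon> * m (Suc t)))"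
      using mexp_step[OF herm[OF t(1)] M(1)[OF t(3)] M(2)[OF t(3)] \<epsilon>]
      by (simp add: Z_def A algebra_simps)
    \<comment> \<open>Passing from \<open>1 + x\<close> to \<open>exp x\<close> turns the product of
      the one-step factors into a sum in the exponent.\<close>
    also have "\<dots> \<le> Z t * exp (\<epsilon>\<^sup>2 - \<epsilon> * m (Suc t))"
      using Z_pos[OF t(1)] by (intro mult_left_mono exp_ge_add_one_self) simp
    also have "\<dots> \<le> CARD('n) * exp (\<Sum>\<tau>=1..t. \<epsilon>\<^sup>2 - \<epsilon> * m \<tau>) * exp (\<epsilon>\<^sup>2 - \<epsilon> * m (Suc t))"
      using Suc t by (intro mult_right_mono) auto
    finally show ?case
      by (simp add: exp_add)
  qed
  from this[OF order_refl] have "exp (Re (hs_inner (A T) \<sigma>)) \<le> CARD('n) * exp (\<Sum>\<tau>=1..T. \<epsilon>\<^sup>2 - \<epsilon> * m \<tau>)"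
    using exp_hs_inner_le_trace_mexp[OF herm[OF order_refl] \<sigma>] by (simp add: Z_def)
  also have "\<dots> = exp (ln CARD('n) + (\<Sum>\<tau>=1..T. \<epsilon>\<^sup>2 - \<epsilon> * m \<tau>))"
    by (simp add: exp_add)
  finally have "Re (hs_inner (A T) \<sigma>) \<le> ln CARD('n) + (T * \<epsilon>\<^sup>2 - \<epsilon> * (\<Sum>\<tau>=1..T. m \<tau>))"
    by (simp add: sum_subtractf sum_distrib_left)
  moreover have "Re (hs_inner (A T) \<sigma>) = - \<epsilon> * (\<Sum>t=1..T. Re (hs_inner (M t) \<sigma>))"
    unfolding A_def hs_inner_scaleR_left hs_inner_sum_left by simp
  ultimately show ?thesis
    by (simp add: m_def)
qed

section \<open>Accuracy of the averaged payoff\<close>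

theorem theorem4:
  fixes Q0 Q1 :: "complex^'x^'x \<Rightarrow> complex^'y^'y"
    and A0 A1 :: "complex^'x^('y::finite \<times> 'z::finite)"
    and \<Xi> :: "complex^('x::finite \<times> 'x)^('x \<times> 'x) \<Rightarrow> complex^('z \<times> 2)^('z \<times> 2)"
    and W \<rho> M :: "nat \<Rightarrow> complex^('x \<times> 'x)^('x \<times> 'x)"
    and P :: "nat \<Rightarrow> complex^('z \<times> 2)^('z \<times> 2)"
    and N T :: nat
    and \<delta> \<epsilon> :: real
    and val :: complex
  assumes "admissible_channel Q0" and "admissible_channel Q1"
    and "isometry A0" and "isometry A1"
    and "\<And>X. Q0 X = ptrace_snd (A0 ** X ** hadj A0)"
    and "\<And>X. Q1 X = ptrace_snd (A1 ** X ** hadj A1)"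
    and "\<Xi> = Xi A0 A1"
    and "N = CARD('x \<times> 'x)" and "N \<ge> 2"
    and "\<delta> > 0"
    and "\<epsilon> = \<delta> / 4"
    and "T = nat \<lceil>16 * ln (real N) / \<delta>\<^sup>2\<rceil>"
    and "W 1 = mat 1"
    and "\<And>t. t \<in> {1..T} \<Longrightarrow> \<rho> t = cscale (1 / trace (W t)) (W t)"
    and "\<And>t. t \<in> {1..T} \<Longrightarrow> P t = orth_proj (positive_eigenspace (\<Xi> (\<rho> t)))"
    and "\<And>t. t \<in> {1..T} \<Longrightarrow> M t = (1 / 2) *\<^sub>R (superop_adjoint \<Xi> (P t) + mat 1)"
    and "\<And>t. t \<in> {1..T} \<Longrightarrow> W (t + 1) = mexp ((- \<epsilon>) *\<^sub>R (\<Sum>\<tau>=1..t. M \<tau>))"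
    and "val = (1 / of_nat T) * (\<Sum>t=1..T. hs_inner (P t) (\<Xi> (\<rho> t)))"
  shows "cmod (val - complex_of_real (equilibrium_value \<Xi>)) \<le> \<delta>"
proof -
  note A = assms(3,4)
  have \<epsilon>: "0 < \<epsilon>" using assms by simp
  \<comment> \<open>\<open>N \<ge> 2\<close> makes the logarithm positive, so there is at least one
    round and division by \<open>T\<close> is genuine.\<close>
  have "16 * ln N / \<delta>\<^sup>2 > 0"
    using assms(9,10) by simp
  then have T: "16 * ln N / \<delta>\<^sup>2 \<le> T" "0 < T"
    using assms(12) by (simp_all add: real_nat_ceiling_ge)
  have lnN: "ln N \<le> T * \<epsilon>\<^sup>2"
  proof -
    have "\<delta> = 4 * \<epsilon>" using assms(11) by simp
    then show ?thesis
      using T(1) \<epsilon> by (simp add: field_simps power2_eq_square)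
  qed
  define S where "S t = (- \<epsilon>) *\<^sub>R (\<Sum>\<tau>=1..t. M \<tau>)" for t
  \<comment> \<open>The initial weight \<open>mat 1\<close> is the exponential of the empty sum, so
    round 1 fits the common formula.\<close>
  have W: "W (Suc t) = mexp (S t)" if "t \<le> T" for t
    using assms(13) assms(17)[of t] that by (cases "t = 0") (auto simp: S_def mexp_zero)
  \<comment> \<open>A Hermitian exponent makes the next iterate a density operator and the next loss
    operator Hermitian, which in turn keeps the next exponent Hermitian. Hence that property is a
    premise here and is established by induction below.\<close>
  have step: "\<rho> (Suc t) \<in> density_ops \<and> P (Suc t) \<in> measurement_ops \<and>
      psd (M (Suc t)) \<and> psd (mat 1 - M (Suc t)) \<and>
      P (Suc t) = orth_proj (positive_eigenspace (\<Xi> (\<rho> (Suc t)))) \<and> hadj (\<Xi> (\<rho> (Suc t))) = \<Xi> (\<rho> (Suc t))"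
    if t: "t < T" and S: "hadj (S t) = S t" for t
  proof -
    have t': "Suc t \<in> {1..T}" using t by simp
    have \<rho>: "\<rho> (Suc t) \<in> density_ops"
      using normalized_density(2)[OF psd_mexp[OF S] trace_mexp_pos[OF S]] assms(14)[OF t'] W t by simp
    then have "hadj (\<rho> (Suc t)) = \<rho> (Suc t)"
      by (simp add: density_ops_def psd_def)
    then have h: "hadj (\<Xi> (\<rho> (Suc t))) = \<Xi> (\<rho> (Suc t))"
      unfolding assms(7) by (metis Xi_hadj)
    have P: "P (Suc t) \<in> measurement_ops"
      using positive_projection_measurement[OF h] assms(15)[OF t'] by simp
    have "mat 1 - M (Suc t) = (1 / 2) *\<^sub>R (mat 1 - superop_adjoint \<Xi> (P (Suc t)))"
      unfolding assms(16)[OF t'] by (simp add: vec_eq_iff mat_def scaleR_conv_of_real[where 'a=complex] field_simps)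
    then show ?thesis
      using \<rho> P h assms(15)[OF t'] Xi_adjoint_bounds[OF A P] assms(16)[OF t']
      by (simp add: psd_scaleR assms(7) add.commute)
  qed
  have S: "hadj (S t) = S t" if "t \<le> T" for t
    using that
  proof (induction t)
    case (Suc t)
    then have "psd (M (Suc t))" using step by simp
    moreover have "S (Suc t) = S t - \<epsilon> *\<^sub>R M (Suc t)"
      by (simp add: S_def scaleR_add_right)
    ultimately show ?case
      using Suc by (simp add: hadj_diff hadj_scaleR psd_def)
  qed (simp add: S_def hadj_zero)
  have run: "\<rho> t \<in> density_ops \<and> P t \<in> measurement_ops \<and> psd (M t) \<and> psd (mat 1 - M t) \<and>
      P t = orth_proj (positive_eigenspace (\<Xi> (\<rho> t))) \<and> hadj (\<Xi> (\<rho> t)) = \<Xi> (\<rho> t)" if "t \<in> {1..T}" for t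
  proof -
    obtain s where "t = Suc s" "s < T"
      using \<open>t \<in> {1..T}\<close> by (cases t) auto
    then show ?thesis
      using step[of s] S[of s] by (metis less_imp_le)
  qed
  have pairing: "Re (hs_inner (M t) \<sigma>) = (Re (hs_inner (P t) (\<Xi> \<sigma>)) + 1) / 2"
    if "t \<in> {1..T}" "\<sigma> \<in> density_ops" for t \<sigma>
    using that superop_adjoint_works[OF superop_linear_Xi[of A0 A1], of "P t" \<sigma>]
    by (simp add: assms(16) assms(7) hs_inner_scaleR_left hs_inner_add_left hs_inner_mat_1_left density_ops_def)
  let ?S = "\<lambda>\<sigma>. SUP Q\<in>measurement_ops. Re (hs_inner Q (\<Xi> \<sigma>))"
  \<comment> \<open>Infima and suprema of reals can be used only for bounded sets; this bound serves
    both extrema in the equilibrium value.\<close>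
  have bound: "\<bar>Re (hs_inner Q (\<Xi> \<sigma>))\<bar> \<le> 1" if "Q \<in> measurement_ops" "\<sigma> \<in> density_ops" for Q \<sigma>
    using Xi_pairing_bounds[OF A that(1), of \<sigma>] that(2) unfolding assms(7) by (simp add: density_ops_def)
  have bdd: "bdd_above ((\<lambda>Q. Re (hs_inner Q (\<Xi> \<sigma>))) ` measurement_ops)" if "\<sigma> \<in> density_ops" for \<sigma>
    using bound[OF _ that] by (intro bdd_aboveI2[of _ _ 1]) (auto simp: abs_le_iff)
  have S_upper: "Re (hs_inner Q (\<Xi> \<sigma>)) \<le> ?S \<sigma>" if "Q \<in> measurement_ops" "\<sigma> \<in> density_ops" for Q \<sigma>
    by (rule cSUP_upper[OF that(1) bdd[OF that(2)]])
  have one: "1 \<in> {1..T}" using T(2) by simp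
  define v where "v t = Re (hs_inner (P t) (\<Xi> (\<rho> t)))" for t
  have "bdd_below (?S ` density_ops)"
    using bound[of "P 1"] S_upper[of "P 1"] run[OF one] by (intro bdd_belowI2[of _ "- 1"]) (smt (verit))
  then have "equilibrium_value \<Xi> \<le> v t" if "t \<in> {1..T}" for t
  proof -
    have "equilibrium_value \<Xi> \<le> ?S (\<rho> t)"
      unfolding equilibrium_value_def using \<open>bdd_below _\<close> run[OF that] by (intro cINF_lower) auto
    also have "\<dots> \<le> v t"
    proof (rule cSUP_least)
      show "measurement_ops \<noteq> ({} :: (complex^('z \<times> 2)^('z \<times> 2)) set)"
        using run[OF one] by auto
      fix Q :: "complex^('z \<times> 2)^('z \<times> 2)" assume "Q \<in> measurement_ops"
      then show "Re (hs_inner Q (\<Xi> (\<rho> t))) \<le> v t"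
        unfolding v_def using positive_projection_optimal run[OF that] by metis
    qed
    finally show ?thesis .
  qed
  then have "(\<Sum>t=1..T. equilibrium_value \<Xi>) \<le> (\<Sum>t=1..T. v t)"
    by (rule sum_mono)
  then have lower: "equilibrium_value \<Xi> \<le> (\<Sum>t=1..T. v t) / T"
    using T(2) by (simp add: field_simps)
  have upper: "(\<Sum>t=1..T. v t) / T - \<delta> \<le> equilibrium_value \<Xi>"
    unfolding equilibrium_value_def
  proof (rule cINF_greatest)
    show "density_ops \<noteq> ({} :: (complex^('x \<times> 'x)^('x \<times> 'x)) set)"
      using run[OF one] by auto
    fix \<sigma> :: "complex^('x \<times> 'x)^('x \<times> 'x)" assume \<sigma>: "\<sigma> \<in> density_ops"
    have "\<epsilon> * (\<Sum>t=1..T. Re (hs_inner (M t) (\<rho> t)))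
      \<le> \<epsilon> * (\<Sum>t=1..T. Re (hs_inner (M t) \<sigma>)) + ln CARD('x \<times> 'x) + T * \<epsilon>\<^sup>2"
      by (rule matrix_multiplicative_weights_regret[where W = W])
        (use run W assms(14) \<sigma> \<epsilon> in \<open>auto simp: S_def\<close>)
    \<comment> \<open>By \<open>lnN\<close> the initial entropy term costs no more than the
      accumulated second-order terms.\<close>
    also have "\<dots> \<le> \<epsilon> * (\<Sum>t=1..T. Re (hs_inner (M t) \<sigma>)) + 2 * T * \<epsilon>\<^sup>2"
      using lnN assms(8) by simp
    also have "\<dots> = \<epsilon> * ((\<Sum>t=1..T. Re (hs_inner (M t) \<sigma>)) + 2 * T * \<epsilon>)"
      by (simp add: algebra_simps power2_eq_square)
    finally have "(\<Sum>t=1..T. Re (hs_inner (M t) (\<rho> t))) \<le> (\<Sum>t=1..T. Re (hs_inner (M t) \<sigma>)) + 2 * T * \<epsilon>"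
      using \<epsilon> by simp
    moreover have "(\<Sum>t=1..T. Re (hs_inner (M t) (\<rho> t))) = ((\<Sum>t=1..T. v t) + T) / 2"
    proof -
      have "(\<Sum>t=1..T. Re (hs_inner (M t) (\<rho> t))) = (\<Sum>t=1..T. (v t + 1) / 2)"
        unfolding v_def using run by (intro sum.cong refl pairing) blast+
      then show ?thesis by (simp add: sum.distrib flip: sum_divide_distrib)
    qed
    moreover have "(\<Sum>t=1..T. Re (hs_inner (M t) \<sigma>)) = ((\<Sum>t=1..T. Re (hs_inner (P t) (\<Xi> \<sigma>))) + T) / 2"
    proof -
      have "(\<Sum>t=1..T. Re (hs_inner (M t) \<sigma>)) = (\<Sum>t=1..T. (Re (hs_inner (P t) (\<Xi> \<sigma>)) + 1) / 2)"
        using \<sigma> by (intro sum.cong refl pairing)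
      then show ?thesis by (simp add: sum.distrib flip: sum_divide_distrib)
    qed
    moreover have "(\<Sum>t=1..T. Re (hs_inner (P t) (\<Xi> \<sigma>))) \<le> (\<Sum>t=1..T. ?S \<sigma>)"
      using \<sigma> run by (intro sum_mono S_upper) blast+
    \<comment> \<open>Undoing the halving in \<open>M\<close> doubles the loss regret
      \<open>2 T \<epsilon>\<close> to \<open>4 T \<epsilon>\<close>, which is
      \<open>T \<delta>\<close>.\<close>
    ultimately have "(\<Sum>t=1..T. v t) \<le> T * ?S \<sigma> + T * \<delta>"
      using assms(11) by (simp add: field_simps)
    then show "(\<Sum>t=1..T. v t) / T - \<delta> \<le> ?S \<sigma>"
      using T(2) by (simp add: field_simps)
  qed
  \<comment> \<open>Both operators are Hermitian, so the complex average \<open>val\<close> is real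
    and the two one-sided bounds control its modulus distance.\<close>
  have "hs_inner (P t) (\<Xi> (\<rho> t)) = of_real (v t)" if "t \<in> {1..T}" for t
  proof -
    have "P t \<in> measurement_ops" using run[OF that] by blast
    then have "hadj (P t) = P t" by (simp add: measurement_ops_def loewner_le_def psd_def)
    then show ?thesis
      unfolding v_def using run[OF that] by (intro hs_inner_real) blast+
  qed
  then have "val = of_real ((\<Sum>t=1..T. v t) / T)"
    unfolding assms(18) by simp
  then have "cmod (val - of_real (equilibrium_value \<Xi>)) = \<bar>(\<Sum>t=1..T. v t) / T - equilibrium_value \<Xi>\<bar>"
    by (simp only: norm_of_real flip: of_real_diff)
  then show ?thesis
    using lower upper by linarith
qed

end
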